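(* Let $v\in\mathbf{A}^{r\times n}$, and let $I'_v\subset R$ be the ideal generated by the size $|J|$ minors of the matrices $x_J\odot v_J^\perp$, as $J$ ranges over the nonempty subsets of $\{1,\dots,n\}$. Then $\sqrt{I'_v}=I_v$.
   Context: $\mathbf{k}$ is an algebraically closed field of characteristic zero, $R=\mathbf{k}[x_{ij}: 1\le i\le r,\ 1\le j\le n]$, and $\mathbf{A}^{r\times n}=\operatorname{Spec}(R)$ is the space of $r$-by-$n$ matrices. The group $G=\mathrm{GL}_r(\mathbf{k})\times(\mathbf{k}^\times)^n$ acts on $\mathbf{A}^{r\times n}$ by row operations (left multiplication) and rescaling of columns. $X_v$ is the Zariski closure of the orbit $G\cdot v$, an irreducible variety, and $I_v\subset R$ is its (prime) ideal. For $J=\{j_1<\dots<j_\ell\}$, $v_J$ is the submatrix of $v$ on the columns in $J$, and $v_J^\perp$ is any $(\ell-\operatorname{rk}(v_J))$-by-$\ell$ matrix whose rows form a basis of the right kernel of $v_J$. Let $x=(x_{ij})$ be the matrix of variables, with $j$-th column $x_j$. The matrix $x_J\odot v_J^\perp$ has $\ell$ columns, the $i$-th being the tensor $x_{j_i}\otimes (v_J^\perp)_i\in R^r\otimes\mathbf{k}^{\ell-\operatorname{rk}(v_J)}$ written in coordinates. If the columns of $v_J$ are linearly independent, $x_J\odot v_J^\perp$ is interpreted as the zero matrix; if a matrix has fewer than $|J|$ rows, all its size $|J|$ minors are regarded as zero. *)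

theory Defs
  imports
    "HOL-Library.Poly_Mapping"
    "HOL-Algebra.Ideal"
    "HOL-Computational_Algebra.Polynomial"
    "Jordan_Normal_Form.Determinant"
    "Jordan_Normal_Form.Matrix_Kernel"
    "Jordan_Normal_Form.DL_Rank"
    "Jordan_Normal_Form.DL_Submatrix"
begin

text \<open>Rows, columns and the variables \<open>x\<^sub>i\<^sub>j\<close> are indexed from 0.\<close>

section \<open>The coordinate ring of the space of matrices\<close>

text \<open>A polynomial is a finitely supported map from monomials to coefficients, a monomial a finitely
  supported map from variables \<open>(i, j)\<close> to exponents. The type has a variable for every pair of
  natural numbers; the ring \<open>R\<close> in the variables with \<open>i < r\<close> and \<open>j < n\<close> is the subring
  below.\<close>

type_synonym 'k mpoly2 = "((nat \<times> nat) \<Rightarrow>\<^sub>0 nat) \<Rightarrow>\<^sub>0 'k"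

definition const :: "'k::comm_ring_1 \<Rightarrow> 'k mpoly2" where
  "const c = Poly_Mapping.single 0 c"

definition var :: "nat \<times> nat \<Rightarrow> 'k::comm_ring_1 mpoly2" where
  "var ij = Poly_Mapping.single (Poly_Mapping.single ij 1) 1"

definition coord_ring :: "nat \<Rightarrow> nat \<Rightarrow> 'k::comm_ring_1 mpoly2 ring" where
  "coord_ring r n =
     \<lparr>carrier = {p. \<forall>m \<in> Poly_Mapping.keys p. Poly_Mapping.keys m \<subseteq> {..<r} \<times> {..<n}},
      monoid.mult = (*), one = 1, zero = 0, add = (+)\<rparr>"

definition eval_at :: "'k::comm_ring_1 mat \<Rightarrow> 'k mpoly2 \<Rightarrow> 'k" where
  "eval_at w p =
     (\<Sum>m \<in> Poly_Mapping.keys p. Poly_Mapping.lookup p m *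
        (\<Prod>ij \<in> Poly_Mapping.keys m. (w $$ ij) ^ Poly_Mapping.lookup m ij))"

lemma cring_coord_ring: "cring (coord_ring r n :: 'k::comm_ring_1 mpoly2 ring)"
proof -
  let ?R = "coord_ring r n :: 'k mpoly2 ring"
  let ?V = "{..<r} \<times> {..<n}"
  have mem: "p \<in> carrier ?R \<longleftrightarrow> (\<forall>m \<in> Poly_Mapping.keys p. Poly_Mapping.keys m \<subseteq> ?V)" for p
    by (simp add: coord_ring_def)
  have ops: "p \<oplus>\<^bsub>?R\<^esub> q = p + q" "p \<otimes>\<^bsub>?R\<^esub> q = p * q" "\<one>\<^bsub>?R\<^esub> = 1" "\<zero>\<^bsub>?R\<^esub> = 0" for p q
    by (simp_all add: coord_ring_def)
  have add: "p + q \<in> carrier ?R" if "p \<in> carrier ?R" "q \<in> carrier ?R" for p q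
    using that Poly_Mapping.keys_add[of p q] unfolding mem by blast
  have mult: "p * q \<in> carrier ?R" if p: "p \<in> carrier ?R" and q: "q \<in> carrier ?R" for p q
    unfolding mem
  proof
    fix m assume "m \<in> Poly_Mapping.keys (p * q)"
    then obtain a b where "a \<in> Poly_Mapping.keys p" "b \<in> Poly_Mapping.keys q" "m = a + b"
      using keys_mult[of p q] by blast
    then show "Poly_Mapping.keys m \<subseteq> ?V"
      using p q Poly_Mapping.keys_add[of a b] unfolding mem by blast
  qed
  have zero: "0 \<in> carrier ?R" and one: "1 \<in> carrier ?R"
    by (simp_all add: mem)
  have neg: "\<exists>q \<in> carrier ?R. q + p = 0" if "p \<in> carrier ?R" for p
    using that by (intro bexI[of _ "- p"]) (simp_all add: mem)
  have "abelian_group ?R"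
    by (rule abelian_groupI; unfold ops) (assumption | rule add zero neg add.assoc add_0_left add.commute)+
  moreover have "Group.comm_monoid ?R"
    by (rule comm_monoidI; unfold ops) (assumption | rule mult one mult.assoc mult_1_left mult.commute)+
  ultimately show ?thesis
    by (rule cringI) (simp only: ops distrib_right)
qed

definition radical :: "('a, 'b) ring_scheme \<Rightarrow> 'a set \<Rightarrow> 'a set" where
  "radical R I = {f \<in> carrier R. \<exists>k::nat. f [^]\<^bsub>R\<^esub> k \<in> I}"

section \<open>The orbit closure and its ideal\<close>

definition zero_locus :: "nat \<Rightarrow> nat \<Rightarrow> 'k::comm_ring_1 mpoly2 set \<Rightarrow> 'k mat set" where
  "zero_locus r n S = {w \<in> carrier_mat r n. \<forall>p \<in> S. eval_at w p = 0}"

definition zariski_closed :: "nat \<Rightarrow> nat \<Rightarrow> 'k::comm_ring_1 mat set \<Rightarrow> bool" where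
  "zariski_closed r n Z \<longleftrightarrow> (\<exists>S \<subseteq> carrier (coord_ring r n). Z = zero_locus r n S)"

definition zariski_closure :: "nat \<Rightarrow> nat \<Rightarrow> 'k::comm_ring_1 mat set \<Rightarrow> 'k mat set" where
  "zariski_closure r n X = \<Inter> {Z. zariski_closed r n Z \<and> X \<subseteq> Z}"

definition vanishing_ideal :: "nat \<Rightarrow> nat \<Rightarrow> 'k::comm_ring_1 mat set \<Rightarrow> 'k mpoly2 set" where
  "vanishing_ideal r n X = {p \<in> carrier (coord_ring r n). \<forall>w \<in> X. eval_at w p = 0}"

definition matrix_orbit :: "nat \<Rightarrow> nat \<Rightarrow> 'k::field mat \<Rightarrow> 'k mat set" where
  "matrix_orbit r n v =
     {g * v * mat_diag n t | g t. g \<in> carrier_mat r r \<and> invertible_mat g \<and> (\<forall>j < n. t j \<noteq> 0)}"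

definition orbit_closure :: "nat \<Rightarrow> nat \<Rightarrow> 'k::field mat \<Rightarrow> 'k mat set" where
  "orbit_closure r n v = zariski_closure r n (matrix_orbit r n v)"

definition orbit_ideal :: "nat \<Rightarrow> nat \<Rightarrow> 'k::field mat \<Rightarrow> 'k mpoly2 set" where
  "orbit_ideal r n v = vanishing_ideal r n (orbit_closure r n v)"

section \<open>The ideal of minors\<close>

definition cols_submatrix :: "'a mat \<Rightarrow> nat set \<Rightarrow> 'a mat" where
  "cols_submatrix A J = submatrix A UNIV J"

text \<open>\<open>is_perp A P\<close>: \<open>P\<close> is a possible choice of \<open>A\<^sup>\<bottom>\<close>. As \<open>basis\<close> is a predicate on sets,
  the rows are required to be distinct.\<close>

definition is_perp :: "'k::field mat \<Rightarrow> 'k mat \<Rightarrow> bool" where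
  "is_perp A P \<longleftrightarrow>
     P \<in> carrier_mat (dim_col A - vec_space.rank (dim_row A) A) (dim_col A) \<and>
     distinct (rows P) \<and>
     kernel.basis (dim_col A) A (set (rows P))"

lemma is_perp_exists: "\<exists>P. is_perp (A :: 'k::field mat) P"
proof -
  let ?nr = "dim_row A" let ?nc = "dim_col A"
  have A: "A \<in> carrier_mat ?nr ?nc" by simp
  interpret k: kernel ?nr ?nc A by (unfold_locales, rule A)
  interpret W: vec_space "TYPE('k)" ?nr .
  have "(\<lambda>x. A *\<^sub>v x) \<in> LinearCombinations.module_hom class_ring k.NC.V W.V"
    unfolding LinearCombinations.module_hom_def
    by (auto simp: module_vec_simps class_ring_simps intro: mult_add_distrib_mat_vec[OF A] mult_mat_vec[OF A] mult_mat_vec_carrier[OF A])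
  then have "mod_hom class_ring k.NC.V W.V (\<lambda>x. A *\<^sub>v x)"
    by (intro mod_hom.intro mod_hom_axioms.intro k.NC.module_axioms W.module_axioms)
  then have "linear_map class_ring k.NC.V W.V (\<lambda>x. A *\<^sub>v x)"
    by (intro linear_map.intro k.NC.vectorspace_axioms W.vectorspace_axioms)
  then interpret T: linear_map class_ring k.NC.V W.V "\<lambda>x. A *\<^sub>v x" .
  have ker: "T.kerT = mat_kernel A"
    by (auto simp: T.ker_def mat_kernel_def module_vec_simps)
  have im: "T.imT = W.span (set (cols A))"
    unfolding W.col_space_def[symmetric] W.col_space_eq[OF A] T.im_def
    by (auto simp: module_vec_simps intro: mult_mat_vec_carrier[OF A])
  have dim: "W.rank A + k.dim = ?nc"
    using T.rank_nullity[OF k.NC.fin_dim] unfolding ker im W.rank_def k.NC.dim_is_n .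
  from kernel_basis_exists[OF A] obtain B where B: "finite B" "k.basis B" by blast
  from finite_distinct_list[OF B(1)] obtain bs where bs: "set bs = B" "distinct bs" by blast
  have "B \<subseteq> carrier_vec ?nc"
    using B(2) mat_kernel_carrier[OF A] unfolding k.Ker.basis_def by blast
  then have rows: "rows (mat_of_rows ?nc bs) = bs"
    using bs by simp
  have "length bs = ?nc - W.rank A"
    using k.Ker.dim_basis[OF B] dim distinct_card[OF bs(2)] bs(1) by simp
  then have "mat_of_rows ?nc bs \<in> carrier_mat (?nc - W.rank A) ?nc"
    by (auto intro: carrier_matI)
  then show ?thesis
    using bs B(2) rows unfolding is_perp_def by auto
qed

definition generic_matrix :: "nat \<Rightarrow> nat \<Rightarrow> 'k::comm_ring_1 mpoly2 mat" where
  "generic_matrix r n = mat r n var"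

text \<open>The columnwise tensor product; row \<open>a * dim_row B + b\<close> holds the \<open>(a, b)\<close> coordinate.\<close>

definition col_tensor :: "'a::times mat \<Rightarrow> 'a mat \<Rightarrow> 'a mat" where
  "col_tensor A B = mat (dim_row A * dim_row B) (dim_col A)
     (\<lambda>(i, j). A $$ (i div dim_row B, j) * B $$ (i mod dim_row B, j))"

definition minors :: "nat \<Rightarrow> 'a::comm_ring_1 mat \<Rightarrow> 'a set" where
  "minors k M = {det (submatrix M I K) | I K.
     I \<subseteq> {..<dim_row M} \<and> card I = k \<and> K \<subseteq> {..<dim_col M} \<and> card K = k}"

text \<open>If \<open>v\<^sub>J\<close> has independent columns or \<open>x\<^sub>J \<odot> v\<^sub>J\<^sup>\<bottom>\<close> has fewer than \<open>|J|\<close> rows, then \<open>J\<close>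
  contributes no minors, which generates the same ideal as contributing zeros. The argument
  \<open>perp\<close> assigns to each \<open>J\<close> the chosen matrix \<open>v\<^sub>J\<^sup>\<bottom>\<close>.\<close>

definition minors_ideal :: "nat \<Rightarrow> nat \<Rightarrow> (nat set \<Rightarrow> 'k::comm_ring_1 mat) \<Rightarrow> 'k mpoly2 set" where
  "minors_ideal r n perp = Idl\<^bsub>coord_ring r n\<^esub>
     (\<Union>J \<in> {J. J \<subseteq> {..<n} \<and> J \<noteq> {}}.
        minors (card J)
          (col_tensor (cols_submatrix (generic_matrix r n) J) (map_mat const (perp J))))"

end

theory Submission
  imports Defs "Jordan_Normal_Form.Char_Poly"
begin

text \<open>By the Nullstellensatz the claim is geometric: it says that a polynomial vanishes on the orbit of
  \<open>v\<close> if and only if it vanishes at every matrix \<open>w\<close> at which all the minors vanish.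

  The vanishing of the minors at \<open>w\<close> is a statement of linear algebra, proved in
  \<open>minors_vanish_iff\<close>. The size \<open>|J|\<close> minors of \<open>w\<^sub>J \<odot> v\<^sub>J\<^sup>\<bottom>\<close> vanish if and only if its columns have a
  nontrivial relation \<open>t\<close>. This relation says that every row of \<open>w\<^sub>J diag(t)\<close> is orthogonal to the
  kernel of \<open>v\<^sub>J\<close>, hence lies in the row space of \<open>v\<^sub>J\<close>; so the condition is that
  \<open>w\<^sub>J diag(t) = A v\<^sub>J\<close> for some square matrix \<open>A\<close> and some nonzero \<open>t\<close>. On the orbit,
  \<open>w = g v diag(s)\<close>, one can take \<open>t = 1 / s\<close> and \<open>A = g\<close>.

  Conversely, suppose that \<open>w\<close> satisfies this condition for all nonempty \<open>J\<close>. For \<open>J = {..<n}\<close> the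
  equation determines the columns of \<open>w\<close> in the support of \<open>t\<close>, up to scaling, as those of \<open>A v\<close>, while
  \<open>A\<close> annihilates the other columns of \<open>v\<close>. Repeating this on the complement of the support gives
  an ordered partition of the columns and matrices \<open>A\<^sub>0, A\<^sub>1, \<dots>\<close>, and the family
  \<open>G(\<epsilon>) = A\<^sub>0 + \<epsilon> A\<^sub>1 + \<epsilon>\<^sup>2 A\<^sub>2 + \<dots>\<close> satisfies \<open>G(\<epsilon>) v\<^sub>j = c \<epsilon>\<^sup>d (w\<^sub>j + O(\<epsilon>))\<close> for every column \<open>j\<close>. After
  rescaling its columns, \<open>G(\<epsilon>) v\<close> tends to \<open>w\<close>. This is \<open>degenerating_family\<close>; it places \<open>w\<close> in the
  orbit closure because a polynomial in \<open>\<epsilon>\<close> with infinitely many zeros is zero. That \<open>G(\<epsilon>)\<close> may be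
  singular does no harm, since singular matrices are limits of invertible ones
  (\<open>vanishes_at_singular_multiples\<close>).

  For the Nullstellensatz, let \<open>f\<close> be outside the radical of an ideal. There is a prime ideal \<open>P\<close>
  that contains the ideal but not \<open>f\<close>, and it suffices to find a homomorphism from the coordinate ring
  to the field that kills \<open>P\<close> and not \<open>f\<close>: it is the evaluation at a matrix. The variables are
  adjoined one at a time. The lemma \<open>choose_root\<close> shows that a homomorphism on a subring \<open>B\<close> that
  does not kill a suitable \<open>c\<close> extends to \<open>B[y]\<close> without killing a prescribed element outside \<open>P\<close>.
  All computations take place modulo \<open>P\<close>, with pseudo-division in place of
  division in the fraction field of the quotient domain.\<close>

section \<open>Prime ideals that avoid the powers of an element\<close>

text \<open>An ideal \<open>P\<close> that is maximal among the ideals that contain \<open>I\<close> and no power of \<open>f\<close> is prime: if \<open>a\<close>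
  and \<open>b\<close> are outside \<open>P\<close>, then \<open>P + (a)\<close> and \<open>P + (b)\<close> contain powers of \<open>f\<close>, so the product of these
  powers is in \<open>P + (ab)\<close>, and \<open>ab\<close> is outside \<open>P\<close>.\<close>

lemma exists_prime_ideal_avoiding:
  fixes R (structure)
  assumes R: "cring R" and I: "ideal I R" and f: "f \<in> carrier R"
    and avoid: "\<And>k::nat. f [^] k \<notin> I"
  obtains P where "primeideal P R" "I \<subseteq> P" "f \<notin> P"
proof -
  interpret cring R by (rule R)
  define S where "S = {K. ideal K R \<and> I \<subseteq> K \<and> (\<forall>k::nat. f [^] k \<notin> K)}"
  have "\<exists>M\<in>S. \<forall>X\<in>S. M \<subseteq> X \<longrightarrow> X = M"
  proof (rule subset_Zorn_nonempty)
    have "I \<in> S" using I avoid by (simp add: S_def)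
    then show "S \<noteq> {}" by blast
    fix \<C> assume ne: "\<C> \<noteq> {}" and chain: "subset.chain S \<C>"
    have "\<C> \<subseteq> S" using chain by (simp add: subset.chain_def)
    then have id: "ideal K R" "I \<subseteq> K" "\<And>k::nat. f [^] k \<notin> K" if "K \<in> \<C>" for K
      using that unfolding S_def by blast+
    have sub: "additive_subgroup K R" if "K \<in> \<C>" for K
      by (rule ideal.axioms(1)[OF id(1)[OF that]])
    have "ideal (\<Union>\<C>) R"
    proof (rule idealI[OF ring_axioms])
      show "subgroup (\<Union>\<C>) (add_monoid R)"
      proof (rule add.subgroupI)
        show "\<Union>\<C> \<subseteq> carrier R"
          by (rule Union_least) (rule additive_subgroup.a_subset[OF sub])
        obtain K where "K \<in> \<C>" using ne by blast
        then show "\<Union>\<C> \<noteq> {}" using additive_subgroup.zero_closed[OF sub] by blast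
        show "\<ominus> a \<in> \<Union>\<C>" if "a \<in> \<Union>\<C>" for a
          using that additive_subgroup.a_inv_closed[OF sub] unfolding a_inv_def by blast
        fix a b assume "a \<in> \<Union>\<C>" "b \<in> \<Union>\<C>"
        then obtain A B where AB: "A \<in> \<C>" "B \<in> \<C>" "a \<in> A" "b \<in> B" by blast
        then obtain D where "D \<in> \<C>" "a \<in> D" "b \<in> D"
          using chain unfolding subset.chain_def by blast
        then show "a \<oplus> b \<in> \<Union>\<C>"
          using additive_subgroup.a_closed[OF sub] by blast
      qed
    next
      fix a x assume "a \<in> \<Union>\<C>" "x \<in> carrier R"
      then show "x \<otimes> a \<in> \<Union>\<C>" "a \<otimes> x \<in> \<Union>\<C>"
        using ideal.I_l_closed[OF id(1)] ideal.I_r_closed[OF id(1)] by blast+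
    qed
    moreover have "I \<subseteq> \<Union>\<C>" using ne id(2) by blast
    moreover have "f [^] k \<notin> \<Union>\<C>" for k :: nat using id(3) by blast
    ultimately show "\<Union>\<C> \<in> S" by (simp add: S_def)
  qed
  then obtain P where PS: "P \<in> S" and max: "\<And>X. X \<in> S \<Longrightarrow> P \<subseteq> X \<Longrightarrow> X = P"
    by blast
  have P: "ideal P R" "I \<subseteq> P" "\<And>k::nat. f [^] k \<notin> P"
    using PS by (simp_all add: S_def)
  have meets: "\<exists>k::nat. \<exists>p\<in>P. \<exists>x\<in>carrier R. f [^] k = p \<oplus> x \<otimes> a"
    if a: "a \<in> carrier R" "a \<notin> P" for a
  proof -
    have id: "ideal (P <+> PIdl a) R"
      by (rule add_ideals[OF P(1) cgenideal_ideal[OF a(1)]])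
    have zero: "\<zero> \<in> P" "\<zero> \<in> PIdl a"
      using P(1) cgenideal_ideal[OF a(1)] additive_subgroup.zero_closed ideal.axioms(1) by blast+
    have "P \<subseteq> P <+> PIdl a"
    proof
      fix p assume p: "p \<in> P"
      then have "p = p \<oplus> \<zero>" using ideal.Icarr[OF P(1)] by simp
      then show "p \<in> P <+> PIdl a" using p zero(2) unfolding set_add_def' by blast
    qed
    moreover have "a \<in> P <+> PIdl a"
    proof -
      have "a = \<zero> \<oplus> a" using a(1) by simp
      then show ?thesis using zero(1) cgenideal_self[OF a(1)] unfolding set_add_def' by blast
    qed
    ultimately have "P <+> PIdl a \<notin> S" using max a(2) by blast
    then obtain k :: nat where "f [^] k \<in> P <+> PIdl a"
      using id P(2) \<open>P \<subseteq> P <+> PIdl a\<close> by (auto simp: S_def)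
    then show ?thesis
      unfolding set_add_def' cgenideal_def by blast
  qed
  have "primeideal P R"
  proof (rule primeidealI[OF P(1) R])
    show "carrier R \<noteq> P" using P(3)[of 0] by auto
    fix a b assume a: "a \<in> carrier R" and b: "b \<in> carrier R" and ab: "a \<otimes> b \<in> P"
    show "a \<in> P \<or> b \<in> P"
    proof (rule ccontr)
      assume "\<not> (a \<in> P \<or> b \<in> P)"
      then obtain k l :: nat and p q x y where
        k: "f [^] k = p \<oplus> x \<otimes> a" "p \<in> P" "x \<in> carrier R" and
        l: "f [^] l = q \<oplus> y \<otimes> b" "q \<in> P" "y \<in> carrier R"
        using meets a b by meson
      have pq: "p \<in> carrier R" "q \<in> carrier R"
        using k(2) l(2) ideal.Icarr[OF P(1)] by auto
      have "f [^] (k + l) = p \<otimes> f [^] l \<oplus> (x \<otimes> a \<otimes> q \<oplus> (x \<otimes> y) \<otimes> (a \<otimes> b))"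
        unfolding nat_pow_mult[OF f, symmetric] k(1) l(1)
        using k(3) l(3) pq a b by algebra
      moreover have "p \<otimes> f [^] l \<in> P"
        using ideal.I_r_closed[OF P(1) k(2)] f by simp
      moreover have "x \<otimes> a \<otimes> q \<in> P" "(x \<otimes> y) \<otimes> (a \<otimes> b) \<in> P"
        using ideal.I_l_closed[OF P(1)] k(3) l(2,3) a ab by simp_all
      ultimately have "f [^] (k + l) \<in> P"
        using additive_subgroup.a_closed[OF ideal.axioms(1)[OF P(1)]] by simp
      then show False using P(3) by blast
    qed
  qed
  moreover have "f \<notin> P" using P(3)[of 1] f by auto
  ultimately show thesis using that P(2) by blast
qed

section \<open>Polynomials over a subring\<close>

text \<open>Subrings are subsets of a type class ring. Polynomials over a subring are then library polynomials
  over the ambient ring, with a condition on their coefficients.\<close>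

locale unital_subring =
  fixes B :: "'a::comm_ring_1 set"
  assumes one_mem: "1 \<in> B"
    and uminus_mem: "a \<in> B \<Longrightarrow> - a \<in> B"
    and add_mem: "a \<in> B \<Longrightarrow> b \<in> B \<Longrightarrow> a + b \<in> B"
    and mult_mem: "a \<in> B \<Longrightarrow> b \<in> B \<Longrightarrow> a * b \<in> B"
begin

lemma zero_mem: "0 \<in> B"
  using add_mem[OF one_mem uminus_mem[OF one_mem]] by simp

lemma diff_mem: "a \<in> B \<Longrightarrow> b \<in> B \<Longrightarrow> a - b \<in> B"
  using add_mem[OF _ uminus_mem, of a b] by simp

lemma power_mem: "a \<in> B \<Longrightarrow> a ^ n \<in> B"
  by (induction n) (auto simp: one_mem mult_mem)

lemma sum_mem: "(\<And>x. x \<in> X \<Longrightarrow> f x \<in> B) \<Longrightarrow> sum f X \<in> B"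
  by (induction X rule: infinite_finite_induct) (auto simp: zero_mem add_mem)

end

definition polys_over :: "'a::zero set \<Rightarrow> 'a poly set" where
  "polys_over B = {p. \<forall>i. coeff p i \<in> B}"

lemma polys_overI: "(\<And>i. coeff p i \<in> B) \<Longrightarrow> p \<in> polys_over B"
  and polys_overD: "p \<in> polys_over B \<Longrightarrow> coeff p i \<in> B"
  by (auto simp: polys_over_def)

lemma polys_over_mono: "A \<subseteq> B \<Longrightarrow> polys_over A \<subseteq> polys_over B"
  by (auto simp: polys_over_def)

lemma (in unital_subring) unital_subring_polys_over: "unital_subring (polys_over B)"
proof
  show "1 \<in> polys_over B"
    by (auto intro!: polys_overI simp: coeff_1 one_mem zero_mem)
  show "- p \<in> polys_over B" if "p \<in> polys_over B" for p
    using that by (auto simp: polys_over_def uminus_mem)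
  show "p + q \<in> polys_over B" if "p \<in> polys_over B" "q \<in> polys_over B" for p q
    using that by (auto simp: polys_over_def add_mem)
  show "p * q \<in> polys_over B" if "p \<in> polys_over B" "q \<in> polys_over B" for p q
    using that by (auto simp: polys_over_def coeff_mult intro!: sum_mem mult_mem)
qed

context unital_subring
begin

lemmas poly_one_mem = unital_subring.one_mem[OF unital_subring_polys_over]
  and poly_zero_mem = unital_subring.zero_mem[OF unital_subring_polys_over]
  and poly_add_mem = unital_subring.add_mem[OF unital_subring_polys_over]
  and poly_diff_mem = unital_subring.diff_mem[OF unital_subring_polys_over]
  and poly_uminus_mem = unital_subring.uminus_mem[OF unital_subring_polys_over]
  and poly_mult_mem = unital_subring.mult_mem[OF unital_subring_polys_over]

lemma monom_mem: "a \<in> B \<Longrightarrow> monom a n \<in> polys_over B"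
  by (auto simp: polys_over_def zero_mem)

lemma poly_const_mem: "a \<in> B \<Longrightarrow> [:a:] \<in> polys_over B"
  using monom_mem[of a 0] by (simp add: monom_0)

lemma poly_smult_mem: "a \<in> B \<Longrightarrow> p \<in> polys_over B \<Longrightarrow> Polynomial.smult a p \<in> polys_over B"
  by (auto simp: polys_over_def mult_mem)

lemma poly_eval_mem: "p \<in> polys_over B \<Longrightarrow> y \<in> B \<Longrightarrow> poly p y \<in> B"
  unfolding poly_altdef by (intro sum_mem mult_mem power_mem polys_overD)

text \<open>Multiplying \<open>h\<close> by a power of the leading coefficient of \<open>q\<close> makes the usual long division work
  without inverting elements of \<open>B\<close>. The degree bound on the quotient serves to show that it
  has smaller degree than a minimal relation (see \<open>invertible_modulo\<close>).\<close>

lemma pseudo_division: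
  assumes q: "q \<in> polys_over B" and h: "h \<in> polys_over B"
  shows "\<exists>N. \<exists>s\<in>polys_over B. \<exists>m\<in>polys_over B.
           Polynomial.smult (lead_coeff q ^ N) h = q * s + m \<and> (m = 0 \<or> degree m < degree q)
           \<and> degree s \<le> degree h - degree q"
  using h
proof (induction "if h = 0 then 0 else Suc (degree h)" arbitrary: h rule: less_induct)
  case (less h)
  show ?case
  proof (cases "h = 0 \<or> degree h < degree q")
    case True
    then show ?thesis
      using less.prems poly_zero_mem by (intro exI[of _ 0] bexI[of _ 0] bexI[of _ h]) auto
  next
    case False
    define k where "k = degree h - degree q"
    \<comment> \<open>The first step of long division: \<open>g\<close> has smaller degree than \<open>h\<close>.\<close>
    define t where "t = monom (lead_coeff h) k"
    define g where "g = Polynomial.smult (lead_coeff q) h - q * t"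
    have t: "t \<in> polys_over B" unfolding t_def using monom_mem polys_overD less.prems by blast
    have g: "g \<in> polys_over B" unfolding g_def
      using t less.prems q by (intro poly_diff_mem poly_smult_mem poly_mult_mem polys_overD)
    have deg_t: "degree t \<le> k" unfolding t_def by (rule degree_monom_le)
    have "degree (q * t) \<le> degree h"
      using degree_mult_le[of q t] deg_t False k_def by linarith
    then have deg_g: "degree g \<le> degree h"
      unfolding g_def using degree_diff_le degree_smult_le by blast
    have coeff_g: "coeff g (degree h) = 0"
    proof -
      have "coeff (q * t) (degree q + k) = lead_coeff q * lead_coeff h"
        unfolding t_def mult.commute[of q] coeff_monom_mult by simp
      moreover have "degree q + k = degree h" using False k_def by simp
      ultimately show ?thesis unfolding g_def by simp
    qed
    have drop: "g = 0 \<or> degree g < degree h"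
      using deg_g coeff_g by (metis le_neq_implies_less leading_coeff_0_iff)
    then have "(if g = 0 then 0 else Suc (degree g)) < (if h = 0 then 0 else Suc (degree h))"
      using False by auto
    from less.hyps[OF this g] obtain N s m where
      s: "s \<in> polys_over B" "m \<in> polys_over B" "Polynomial.smult (lead_coeff q ^ N) g = q * s + m"
        "m = 0 \<or> degree m < degree q" "degree s \<le> degree g - degree q"
      by blast
    have "Polynomial.smult (lead_coeff q ^ Suc N) h = Polynomial.smult (lead_coeff q ^ N) (g + q * t)"
      unfolding g_def by (simp add: mult.commute)
    also have "\<dots> = q * (s + Polynomial.smult (lead_coeff q ^ N) t) + m"
      by (simp add: smult_add_right s(3) algebra_simps)
    finally have eq: "Polynomial.smult (lead_coeff q ^ Suc N) h = q * (s + Polynomial.smult (lead_coeff q ^ N) t) + m" .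
    have "degree (s + Polynomial.smult (lead_coeff q ^ N) t) \<le> degree h - degree q"
      using s(5) deg_g deg_t k_def degree_smult_le[of "lead_coeff q ^ N" t]
      by (intro degree_add_le) linarith+
    moreover have "s + Polynomial.smult (lead_coeff q ^ N) t \<in> polys_over B"
      using s(1) t q by (intro poly_add_mem poly_smult_mem power_mem polys_overD)
    ultimately show ?thesis using eq s by blast
  qed
qed

end

section \<open>Algebraic and transcendental elements modulo a prime ideal\<close>

text \<open>Here \<open>P\<close> is an ideal of the subring \<open>C\<close>, not of the ambient ring.\<close>

locale prime_in = unital_subring C for C :: "'a::comm_ring_1 set" +
  fixes P :: "'a set"
  assumes sub: "P \<subseteq> C"
    and zero_P: "0 \<in> P"
    and one_P: "1 \<notin> P"
    and add_P: "a \<in> P \<Longrightarrow> b \<in> P \<Longrightarrow> a + b \<in> P"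
    and mult_P: "a \<in> C \<Longrightarrow> b \<in> P \<Longrightarrow> a * b \<in> P"
    and prime_P: "a \<in> C \<Longrightarrow> b \<in> C \<Longrightarrow> a * b \<in> P \<Longrightarrow> a \<in> P \<or> b \<in> P"
begin

lemma uminus_P: "a \<in> P \<Longrightarrow> - a \<in> P"
  using mult_P[of "- 1" a] one_mem uminus_mem by simp

lemma diff_P: "a \<in> P \<Longrightarrow> b \<in> P \<Longrightarrow> a - b \<in> P"
  using add_P[OF _ uminus_P, of a b] by simp

lemma mult_P_right: "a \<in> P \<Longrightarrow> b \<in> C \<Longrightarrow> a * b \<in> P"
  using mult_P[of b a] by (simp add: mult.commute)

lemma power_P: "a \<in> C \<Longrightarrow> a ^ N \<in> P \<Longrightarrow> a \<in> P"
  by (induction N) (auto simp: one_P dest: prime_P intro: power_mem)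

lemma cong_P: "a - b \<in> P \<Longrightarrow> a \<in> P \<longleftrightarrow> b \<in> P"
  using add_P[of "a - b" b] diff_P[of a "a - b"] by auto

lemma polys_over_P_add: "p \<in> polys_over P \<Longrightarrow> q \<in> polys_over P \<Longrightarrow> p + q \<in> polys_over P"
  by (auto simp: polys_over_def add_P)

lemma sum_P: "(\<And>x. x \<in> X \<Longrightarrow> f x \<in> P) \<Longrightarrow> sum f X \<in> P"
  by (induction X rule: infinite_finite_induct) (auto simp: zero_P add_P)

lemma poly_P: "p \<in> polys_over P \<Longrightarrow> y \<in> C \<Longrightarrow> poly p y \<in> P"
  unfolding poly_altdef by (intro sum_P mult_P_right power_mem polys_overD)

end

lemma degree_drop_lead:
  "p - monom (lead_coeff p) (degree p) = 0 \<or>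
   degree (p - monom (lead_coeff p) (degree p)) < degree (p :: 'a::comm_ring_1 poly)"
proof -
  let ?q = "p - monom (lead_coeff p) (degree p)"
  have "degree ?q \<le> degree p"
    by (rule degree_diff_le) (auto intro: degree_monom_le)
  moreover have "coeff ?q (degree p) = 0" by simp
  ultimately show ?thesis by (metis le_neq_implies_less leading_coeff_0_iff)
qed

locale simple_extension = prime_in C P + base: unital_subring B
  for C P and B :: "'a::comm_ring_1 set" +
  fixes y :: 'a
  assumes B_sub: "B \<subseteq> C" and y_mem: "y \<in> C"
begin

lemma value_mem: "p \<in> polys_over B \<Longrightarrow> poly p y \<in> C"
  using poly_eval_mem y_mem polys_over_mono[OF B_sub] by blast

text \<open>The kernel of the evaluation homomorphism from \<open>B[Y]\<close> to \<open>C / P\<close> at \<open>y\<close>.\<close>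

definition relations :: "'a poly set" where
  "relations = {p \<in> polys_over B. poly p y \<in> P}"

text \<open>Modulo \<open>P\<close>, a polynomial over \<open>B\<close> becomes a polynomial over a domain. Discarding the top terms that
  vanish there leaves a representative whose leading coefficient is the true one.\<close>

lemma lead_outside:
  assumes p: "p \<in> polys_over B" and out: "p \<notin> polys_over P"
  obtains q where "q \<in> polys_over B" "lead_coeff q \<notin> P" "p - q \<in> polys_over P" "degree q \<le> degree p"
proof -
  have "\<exists>q\<in>polys_over B. lead_coeff q \<notin> P \<and> p - q \<in> polys_over P \<and> degree q \<le> degree p"
    using assms
  proof (induction "degree p" arbitrary: p rule: less_induct)
    case less
    let ?t = "monom (lead_coeff p) (degree p)"
    show ?case
    proof (cases "lead_coeff p \<in> P")
      case False
      then show ?thesis using less.prems zero_P by (intro bexI[of _ p]) (auto simp: polys_over_def)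
    next
      case True
      have t: "?t \<in> polys_over P" using True zero_P by (auto simp: polys_over_def)
      have pt: "p - ?t \<in> polys_over B"
        using less.prems(1) by (intro base.poly_diff_mem base.monom_mem polys_overD)
      have "p = (p - ?t) + ?t" by simp
      then have out': "p - ?t \<notin> polys_over P"
        using t less.prems(2) polys_over_P_add by metis
      moreover have "0 \<in> polys_over P" using zero_P by (simp add: polys_over_def)
      ultimately have "p - ?t \<noteq> 0" by metis
      then have deg: "degree (p - ?t) < degree p" using degree_drop_lead[of p] by blast
      from less.hyps[OF this pt out'] obtain q where
        q: "q \<in> polys_over B" "lead_coeff q \<notin> P" "p - ?t - q \<in> polys_over P"
          "degree q \<le> degree (p - ?t)" by blast
      have "p - q = (p - ?t - q) + ?t" by simp
      then have "p - q \<in> polys_over P"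
        using t q(3) polys_over_P_add by metis
      then show ?thesis using q deg by (intro bexI[of _ q]) auto
    qed
  qed
  then show thesis using that by blast
qed

text \<open>A relation of least degree among those that are nonzero modulo \<open>P\<close> plays the part of the minimal
  polynomial of \<open>y\<close> over the fraction field of \<open>B\<close> modulo \<open>P\<close>.\<close>

lemma minimal_relation:
  assumes "\<not> relations \<subseteq> polys_over P"
  obtains q where "q \<in> relations" "lead_coeff q \<notin> P" "degree q > 0"
    "\<And>h. h \<in> relations \<Longrightarrow> h = 0 \<or> degree h < degree q \<Longrightarrow> h \<in> polys_over P"
proof -
  define S where "S = relations - polys_over P"
  obtain p where p: "p \<in> S" "\<And>h. h \<in> S \<Longrightarrow> degree p \<le> degree h"
    using assms exists_least_iff[of "\<lambda>d. \<exists>p\<in>S. degree p = d"] unfolding S_def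
    by (metis Diff_iff not_less subsetI)
  then obtain q where q: "q \<in> polys_over B" "lead_coeff q \<notin> P" "p - q \<in> polys_over P"
      "degree q \<le> degree p"
    using lead_outside[of p] unfolding S_def relations_def by blast
  have "poly p y - poly q y \<in> P" using poly_P[OF q(3) y_mem] by simp
  then have rel: "q \<in> relations"
    using p(1) q(1) cong_P unfolding S_def relations_def by blast
  moreover have "degree q > 0"
  proof (rule ccontr)
    assume "\<not> degree q > 0"
    then obtain c where "q = [:c:]" using degree_eq_zeroE by blast
    then show False using rel q(2) unfolding relations_def by (simp split: if_splits)
  qed
  moreover have "h \<in> polys_over P" if "h \<in> relations" "h = 0 \<or> degree h < degree q" for h
  proof (cases "h = 0")
    case True
    then show ?thesis using zero_P by (simp add: polys_over_def)
  next
    case False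
    then show ?thesis using p(2)[of h] that q(4) unfolding S_def by force
  qed
  ultimately show thesis using q(2) that by blast
qed

text \<open>If \<open>y\<close> is algebraic, adjoining it to the fraction field \<open>K\<close> of \<open>B\<close> modulo \<open>P\<close> gives a field \<open>K[y]\<close>.
  Without denominators this says that a value \<open>F(y)\<close> outside \<open>P\<close> has a multiple that is congruent to an
  element \<open>e\<close> of \<open>B\<close> outside \<open>P\<close>. The proof is the Euclidean algorithm for \<open>q\<close> and \<open>F\<close>: first \<open>F\<close> is
  reduced modulo \<open>q\<close>; then dividing \<open>q\<close> by \<open>F\<close> gives a remainder of smaller degree whose value is
  congruent to a multiple of \<open>F(y)\<close>. This remainder cannot be a relation: then the quotient
  would be one too, both would be zero modulo \<open>P\<close> as their degrees are smaller than that of \<open>q\<close>, and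
  \<open>q\<close> would be zero modulo \<open>P\<close>.\<close>

lemma invertible_modulo:
  assumes q: "q \<in> relations" "lead_coeff q \<notin> P" "degree q > 0"
    and min: "\<And>h. h \<in> relations \<Longrightarrow> h = 0 \<or> degree h < degree q \<Longrightarrow> h \<in> polys_over P"
    and F: "F \<in> polys_over B" "poly F y \<notin> P"
  shows "\<exists>G\<in>polys_over B. \<exists>e\<in>B - P. poly G y * poly F y - e \<in> P"
proof -
  have qB: "q \<in> polys_over B" "poly q y \<in> P" using q(1) by (auto simp: relations_def)
  have small: "\<exists>G\<in>polys_over B. \<exists>e\<in>B - P. poly G y * poly F y - e \<in> P"
    if "F \<in> polys_over B" "poly F y \<notin> P" "degree F < degree q" for F
    using that
  proof (induction "degree F" arbitrary: F rule: less_induct)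
    case less
    have "F \<notin> polys_over P" using less.prems(2) poly_P y_mem by blast
    then obtain H where H: "H \<in> polys_over B" "lead_coeff H \<notin> P" "F - H \<in> polys_over P"
        "degree H \<le> degree F"
      using lead_outside[OF less.prems(1)] by blast
    have FH: "poly F y - poly H y \<in> P" using poly_P[OF H(3) y_mem] by simp
    then have Hy: "poly H y \<notin> P" using less.prems(2) cong_P by blast
    show ?case
    proof (cases "degree H = 0")
      case True
      then obtain e where e: "H = [:e:]" using degree_eq_zeroE by blast
      then have "e \<in> B - P" using polys_overD[OF H(1), of 0] Hy by simp
      moreover have "poly 1 y * poly F y - e \<in> P" using FH e by simp
      ultimately show ?thesis using base.poly_one_mem by blast
    next
      case False
      obtain N s m where s: "s \<in> polys_over B" "m \<in> polys_over B"
          "Polynomial.smult (lead_coeff H ^ N) q = H * s + m" "m = 0 \<or> degree m < degree H"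
          "degree s \<le> degree q - degree H"
        using base.pseudo_division[OF H(1) qB(1)] by blast
      have HC: "lead_coeff H ^ N \<in> C" using polys_overD[OF H(1)] B_sub power_mem by blast
      have ev: "poly H y * poly s y + poly m y \<in> P"
        using mult_P[OF HC qB(2)] arg_cong[OF s(3), of "\<lambda>p. poly p y"] by simp
      show ?thesis
      proof (cases "poly m y \<in> P")
        case True
        \<comment> \<open>Then \<open>s\<close> and \<open>m\<close> are zero modulo \<open>P\<close>, hence so is \<open>q\<close>, up to a factor outside \<open>P\<close>.\<close>
        have "poly H y * poly s y \<in> P" using ev True diff_P by fastforce
        then have "poly s y \<in> P" using prime_P value_mem H(1) s(1) Hy by blast
        then have "s \<in> polys_over P"
          using min[of s] s(1,5) False q(3) unfolding relations_def by force
        moreover have "m \<in> polys_over P"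
          using min[of m] True s(2,4) H(4) less.prems(3) unfolding relations_def by auto
        ultimately have "coeff (H * s + m) (degree q) \<in> P"
          using H(1) B_sub by (auto simp: coeff_mult polys_over_def intro!: add_P sum_P mult_P)
        then have "lead_coeff H ^ N * lead_coeff q \<in> P" unfolding s(3)[symmetric] by simp
        then show ?thesis
          using prime_P[OF HC] power_P[of "lead_coeff H" N] H(1,2) q(2) qB(1) B_sub polys_overD by blast
      next
        case False
        then have "m \<noteq> 0" using zero_P by auto
        then have "degree m < degree F" using s(4) H(4) by simp
        from less.hyps[OF this s(2) False] less.prems(3) this obtain G e where
          G: "G \<in> polys_over B" "e \<in> B - P" "poly G y * poly m y - e \<in> P" by auto
        have mem: "poly G y \<in> C" "poly s y \<in> C" using value_mem G(1) s(1) by auto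
        have "poly (- (G * s)) y * poly F y - e =
            (poly G y * poly m y - e) - poly G y * (poly H y * poly s y + poly m y)
            - (poly G y * poly s y) * (poly F y - poly H y)"
          by (simp add: algebra_simps)
        also have "\<dots> \<in> P"
          by (rule diff_P[OF diff_P[OF G(3) mult_P[OF mem(1) ev]] mult_P[OF mult_mem[OF mem] FH]])
        finally show ?thesis
          using G(1,2) s(1) by (intro bexI[of _ "- (G * s)"] bexI[of _ e])
            (auto intro: base.poly_uminus_mem base.poly_mult_mem)
      qed
    qed
  qed
  obtain N s m where s: "s \<in> polys_over B" "m \<in> polys_over B"
      "Polynomial.smult (lead_coeff q ^ N) F = q * s + m" "m = 0 \<or> degree m < degree q"
    using base.pseudo_division[OF qB(1) F(1)] by blast
  let ?c = "lead_coeff q ^ N"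
  have c: "?c \<in> B" "?c \<in> C" "?c \<notin> P"
    using polys_overD[OF qB(1)] base.power_mem B_sub power_P[of "lead_coeff q" N] q(2) by blast+
  have ev: "?c * poly F y - poly m y = poly q y * poly s y"
    using arg_cong[OF s(3), of "\<lambda>p. poly p y"] by simp
  have cong: "?c * poly F y - poly m y \<in> P"
    unfolding ev using qB(2) value_mem[OF s(1)] by (rule mult_P_right)
  have "?c * poly F y \<notin> P" using prime_P[OF c(2) value_mem[OF F(1)]] c(3) F(2) by blast
  then have my: "poly m y \<notin> P" using cong cong_P by blast
  then have "degree m < degree q" using s(4) zero_P q(3) by auto
  from small[OF s(2) my this] obtain G e where
    G: "G \<in> polys_over B" "e \<in> B - P" "poly G y * poly m y - e \<in> P" by blast
  have "poly (Polynomial.smult ?c G) y * poly F y - e =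
      poly G y * (?c * poly F y - poly m y) + (poly G y * poly m y - e)"
    by (simp add: algebra_simps)
  also have "\<dots> \<in> P" 
    by (rule add_P[OF mult_P[OF value_mem[OF G(1)] cong] G(3)])
  finally show ?thesis using G c(1) base.poly_smult_mem by blast
qed

end

section \<open>Extending homomorphisms to the field\<close>

definition adjoin :: "'a::comm_ring_1 set \<Rightarrow> 'a \<Rightarrow> 'a set" where
  "adjoin B y = {poly p y | p. p \<in> polys_over B}"

abbreviation adjoin_list :: "'a::comm_ring_1 list \<Rightarrow> 'a set \<Rightarrow> 'a set" where
  "adjoin_list \<equiv> foldr (\<lambda>y A. adjoin A y)"

lemma (in unital_subring) unital_subring_adjoin: "unital_subring (adjoin B y)"
proof
  show "1 \<in> adjoin B y"
    unfolding adjoin_def using poly_one_mem by (auto intro!: exI[of _ 1])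
  fix a b assume a: "a \<in> adjoin B y"
  then obtain p where p: "a = poly p y" "p \<in> polys_over B" unfolding adjoin_def by blast
  show "- a \<in> adjoin B y"
    unfolding adjoin_def using p poly_uminus_mem by (auto intro!: exI[of _ "- p"])
  assume "b \<in> adjoin B y"
  then obtain q where q: "b = poly q y" "q \<in> polys_over B" unfolding adjoin_def by blast
  show "a + b \<in> adjoin B y"
    unfolding adjoin_def using p q poly_add_mem by (auto intro!: exI[of _ "p + q"])
  show "a * b \<in> adjoin B y"
    unfolding adjoin_def using p q poly_mult_mem by (auto intro!: exI[of _ "p * q"])
qed

lemma (in unital_subring) adjoin_base: "a \<in> B \<Longrightarrow> a \<in> adjoin B y"
  unfolding adjoin_def using poly_const_mem by (auto intro!: exI[of _ "[:a:]"])

lemma (in unital_subring) adjoin_generator: "y \<in> adjoin B y"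
  unfolding adjoin_def using monom_mem[OF one_mem, of 1]
  by (auto intro!: exI[of _ "monom 1 1"] simp: poly_monom)

text \<open>Geometrically, \<open>\<phi>\<close> is a point of the variety with coordinate ring \<open>B / (P \<inter> B)\<close>. As a function it is
  total, but only its values on \<open>B\<close> are constrained.\<close>

locale point_mod = base: unital_subring B for B :: "'a::comm_ring_1 set" +
  fixes P :: "'a set" and \<phi> :: "'a \<Rightarrow> 'k::field"
  assumes map_one: "\<phi> 1 = 1"
    and map_add: "a \<in> B \<Longrightarrow> b \<in> B \<Longrightarrow> \<phi> (a + b) = \<phi> a + \<phi> b"
    and map_mult: "a \<in> B \<Longrightarrow> b \<in> B \<Longrightarrow> \<phi> (a * b) = \<phi> a * \<phi> b"
    and map_P: "a \<in> B \<Longrightarrow> a \<in> P \<Longrightarrow> \<phi> a = 0"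
begin

lemma map_zero: "\<phi> 0 = 0"
  using map_add[OF base.zero_mem base.zero_mem] by (metis add_cancel_right_right add_0)

lemma map_power: "a \<in> B \<Longrightarrow> \<phi> (a ^ N) = \<phi> a ^ N"
  by (induction N) (auto simp: map_one map_mult base.power_mem)

lemma map_sum: "(\<And>x. x \<in> X \<Longrightarrow> f x \<in> B) \<Longrightarrow> \<phi> (sum f X) = (\<Sum>x\<in>X. \<phi> (f x))"
  by (induction X rule: infinite_finite_induct) (auto simp: map_zero map_add base.sum_mem)

lemma map_prod: "(\<And>x. x \<in> X \<Longrightarrow> f x \<in> B) \<Longrightarrow> prod f X \<in> B \<and> \<phi> (prod f X) = (\<Prod>x\<in>X. \<phi> (f x))"
  by (induction X rule: infinite_finite_induct) (auto simp: map_one map_mult base.one_mem base.mult_mem)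

lemma coeff_map: "coeff (map_poly \<phi> p) i = \<phi> (coeff p i)"
  by (simp add: coeff_map_poly map_zero)

lemma map_poly_plus:
  "p \<in> polys_over B \<Longrightarrow> q \<in> polys_over B \<Longrightarrow> map_poly \<phi> (p + q) = map_poly \<phi> p + map_poly \<phi> q"
  by (intro poly_eqI) (simp add: coeff_map map_add polys_overD)

lemma map_poly_times:
  "p \<in> polys_over B \<Longrightarrow> q \<in> polys_over B \<Longrightarrow> map_poly \<phi> (p * q) = map_poly \<phi> p * map_poly \<phi> q"
  by (intro poly_eqI)
    (simp add: coeff_map coeff_mult map_sum map_mult polys_overD base.mult_mem)

lemma map_poly_scale:
  "a \<in> B \<Longrightarrow> p \<in> polys_over B \<Longrightarrow> map_poly \<phi> (Polynomial.smult a p) = Polynomial.smult (\<phi> a) (map_poly \<phi> p)"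
  by (intro poly_eqI) (simp add: coeff_map map_mult polys_overD)

lemma map_poly_minus:
  assumes "p \<in> polys_over B" "q \<in> polys_over B"
  shows "map_poly \<phi> (p - q) = map_poly \<phi> p - map_poly \<phi> q"
  using map_poly_plus[OF base.poly_diff_mem[OF assms] assms(2)] by simp

lemma map_poly_constant: "map_poly \<phi> [:a:] = [:\<phi> a:]"
  by (intro poly_eqI) (simp add: coeff_map coeff_pCons map_zero split: nat.split)

end

context simple_extension
begin

text \<open>The extension sends \<open>p(y)\<close> to the value at \<open>\<alpha>\<close> of the image of \<open>p\<close> under \<open>\<phi>\<close>. Two polynomials with the
  same value at \<open>y\<close> differ by a relation, so the hypothesis on \<open>\<alpha>\<close> makes this well defined.\<close>

lemma extend_point:
  fixes \<phi> :: "'a \<Rightarrow> 'k::field"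
  assumes "point_mod B P \<phi>"
    and root: "\<And>h. h \<in> relations \<Longrightarrow> poly (map_poly \<phi> h) \<alpha> = 0"
  obtains \<psi> where "point_mod (adjoin B y) P \<psi>"
    "\<And>p. p \<in> polys_over B \<Longrightarrow> \<psi> (poly p y) = poly (map_poly \<phi> p) \<alpha>"
proof -
  interpret point_mod B P \<phi> by (rule assms(1))
  define \<psi> where "\<psi> a = poly (map_poly \<phi> (SOME p. p \<in> polys_over B \<and> poly p y = a)) \<alpha>" for a
  have val: "\<psi> (poly p y) = poly (map_poly \<phi> p) \<alpha>" if p: "p \<in> polys_over B" for p
  proof -
    define q where "q = (SOME q. q \<in> polys_over B \<and> poly q y = poly p y)"
    have "q \<in> polys_over B \<and> poly q y = poly p y" unfolding q_def by (rule someI[of _ p]) (use p in simp)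
    then have q: "q \<in> polys_over B" "q - p \<in> relations"
      using p zero_P base.poly_diff_mem by (auto simp: relations_def)
    then show ?thesis
      using root[OF q(2)] map_poly_minus[OF q(1) p] unfolding \<psi>_def q_def[symmetric] by simp
  qed
  have "point_mod (adjoin B y) P \<psi>"
  proof (intro point_mod.intro point_mod_axioms.intro base.unital_subring_adjoin)
    show "\<psi> 1 = 1"
      using val[OF base.poly_const_mem[OF base.one_mem]] by (simp add: map_poly_constant map_one)
    fix a assume "a \<in> adjoin B y"
    then obtain p where p: "a = poly p y" "p \<in> polys_over B" unfolding adjoin_def by blast
    show "a \<in> P \<Longrightarrow> \<psi> a = 0" using root[of p] p val by (simp add: relations_def)
    fix b assume "b \<in> adjoin B y"
    then obtain q where q: "b = poly q y" "q \<in> polys_over B" unfolding adjoin_def by blast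
    show "\<psi> (a + b) = \<psi> a + \<psi> b"
      using val[OF base.poly_add_mem[OF p(2) q(2)]] p q val by (simp add: map_poly_plus)
    show "\<psi> (a * b) = \<psi> a * \<psi> b"
      using val[OF base.poly_mult_mem[OF p(2) q(2)]] p q val by (simp add: map_poly_times)
  qed
  then show thesis using val that by blast
qed

text \<open>If \<open>y\<close> is transcendental modulo \<open>P\<close>, every \<open>\<alpha>\<close> is compatible with the relations, and it only has to
  avoid the roots of the image of \<open>F\<close>; this image is nonzero as soon as \<open>\<phi>\<close> does not kill the coefficient
  \<open>c\<close> of \<open>F\<close>.

  If \<open>y\<close> is algebraic, \<open>\<alpha>\<close> has to be a root of the image of the minimal relation \<open>q\<close>; there is one
  if \<open>\<phi>\<close> does not kill the leading coefficient of \<open>q\<close>. Pseudo-division by \<open>q\<close> shows that \<open>\<alpha>\<close> is then a root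
  of all relations. As \<open>F G - e\<close> is a relation for the elements provided by
  \<open>invertible_modulo\<close>, the image of \<open>F\<close> does not vanish at \<open>\<alpha>\<close> if \<open>\<phi>\<close> does not kill \<open>e\<close> either.\<close>

lemma choose_root:
  assumes F: "F \<in> polys_over B" "poly F y \<notin> P"
  obtains c where "c \<in> B" "c \<notin> P"
    "\<And>\<phi> :: 'a \<Rightarrow> 'k::{alg_closed_field, field_char_0}. point_mod B P \<phi> \<Longrightarrow> \<phi> c \<noteq> 0 \<Longrightarrow>
       \<exists>\<alpha>. (\<forall>h\<in>relations. poly (map_poly \<phi> h) \<alpha> = 0) \<and> poly (map_poly \<phi> F) \<alpha> \<noteq> 0"
proof (cases "relations \<subseteq> polys_over P")
  case True
  have "F \<notin> polys_over P" using F(2) poly_P y_mem by blast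
  then obtain i where i: "coeff F i \<notin> P" by (auto simp: polys_over_def)
  have "\<exists>\<alpha>. (\<forall>h\<in>relations. poly (map_poly \<phi> h) \<alpha> = 0) \<and> poly (map_poly \<phi> F) \<alpha> \<noteq> 0"
    if \<phi>: "point_mod B P \<phi>" and c: "\<phi> (coeff F i) \<noteq> 0" for \<phi> :: "'a \<Rightarrow> 'k"
  proof -
    interpret point_mod B P \<phi> by (rule \<phi>)
    have "map_poly \<phi> F \<noteq> 0" using c coeff_map[of F i] by auto
    then have "finite {\<alpha>. poly (map_poly \<phi> F) \<alpha> = 0}" by (rule poly_roots_finite)
    then obtain \<alpha> where "poly (map_poly \<phi> F) \<alpha> \<noteq> 0"
      using infinite_UNIV_char_0[where 'a = 'k] by (metis (mono_tags) UNIV_eq_I mem_Collect_eq)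
    moreover have "map_poly \<phi> h = 0" if "h \<in> relations" for h
    proof (intro poly_eqI)
      fix j
      have "coeff h j \<in> B" "coeff h j \<in> P"
        using that True by (auto simp: relations_def polys_over_def)
      then show "coeff (map_poly \<phi> h) j = coeff 0 j" by (simp add: coeff_map map_P)
    qed
    ultimately show ?thesis by (intro exI[of _ \<alpha>]) simp
  qed
  then show thesis using that i polys_overD[OF F(1)] by blast
next
  case False
  obtain q where q: "q \<in> relations" "lead_coeff q \<notin> P" "degree q > 0"
      and min: "\<And>h. h \<in> relations \<Longrightarrow> h = 0 \<or> degree h < degree q \<Longrightarrow> h \<in> polys_over P"
    using minimal_relation[OF False] by blast
  have qB: "q \<in> polys_over B" "poly q y \<in> P" using q(1) by (auto simp: relations_def)
  obtain G e where G: "G \<in> polys_over B" "e \<in> B" "e \<notin> P" "poly G y * poly F y - e \<in> P"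
    using invertible_modulo[OF q min F] by blast
  have lB: "lead_coeff q \<in> B" using polys_overD[OF qB(1)] .
  have "\<exists>\<alpha>. (\<forall>h\<in>relations. poly (map_poly \<phi> h) \<alpha> = 0) \<and> poly (map_poly \<phi> F) \<alpha> \<noteq> 0"
    if \<phi>: "point_mod B P \<phi>" and c: "\<phi> (lead_coeff q * e) \<noteq> 0" for \<phi> :: "'a \<Rightarrow> 'k"
  proof -
    interpret point_mod B P \<phi> by (rule \<phi>)
    have c': "\<phi> (lead_coeff q) \<noteq> 0" "\<phi> e \<noteq> 0" using c map_mult[OF lB G(2)] by auto
    have "degree (map_poly \<phi> q) \<ge> degree q"
      using c'(1) by (intro le_degree) (simp add: coeff_map)
    then obtain \<alpha> where \<alpha>: "poly (map_poly \<phi> q) \<alpha> = 0"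
      using alg_closed_imp_poly_has_root[of "map_poly \<phi> q"] q(3) by auto
    have root: "poly (map_poly \<phi> h) \<alpha> = 0" if h: "h \<in> relations" for h
    proof -
      have hB: "h \<in> polys_over B" "poly h y \<in> P" using h by (auto simp: relations_def)
      obtain N s m where s: "s \<in> polys_over B" "m \<in> polys_over B"
          "Polynomial.smult (lead_coeff q ^ N) h = q * s + m" "m = 0 \<or> degree m < degree q"
        using base.pseudo_division[OF qB(1) hB(1)] by blast
      have lN: "lead_coeff q ^ N \<in> B" using lB base.power_mem by blast
      have "poly m y = lead_coeff q ^ N * poly h y - poly q y * poly s y"
        using arg_cong[OF s(3), of "\<lambda>p. poly p y"] by simp
      then have "poly m y \<in> P"
        using diff_P[OF mult_P[OF _ hB(2)] mult_P_right[OF qB(2) value_mem[OF s(1)]]] lN B_sub by auto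
      then have "m \<in> polys_over P" using min[of m] s(2,4) by (simp add: relations_def)
      then have "map_poly \<phi> m = 0"
        using s(2) by (intro poly_eqI) (simp add: coeff_map map_P polys_overD)
      then have "Polynomial.smult (\<phi> (lead_coeff q) ^ N) (map_poly \<phi> h) = map_poly \<phi> q * map_poly \<phi> s"
        using arg_cong[OF s(3), of "map_poly \<phi>"] s(1,2) hB(1) qB(1) lB
        by (simp add: map_poly_scale lN map_poly_plus map_poly_times base.poly_mult_mem map_power)
      then have "\<phi> (lead_coeff q) ^ N * poly (map_poly \<phi> h) \<alpha> = 0"
        using \<alpha> by (metis mult_zero_left poly_mult poly_smult)
      then show ?thesis using c'(1) by simp
    qed
    have "G * F - [:e:] \<in> relations"
      using G F(1) by (auto simp: relations_def intro!: base.poly_diff_mem base.poly_mult_mem base.poly_const_mem)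
    from root[OF this] have "poly (map_poly \<phi> G) \<alpha> * poly (map_poly \<phi> F) \<alpha> = \<phi> e"
      using G F(1)
      by (simp add: map_poly_minus map_poly_times map_poly_constant base.poly_mult_mem base.poly_const_mem)
    then show ?thesis using root c'(2) by (intro exI[of _ \<alpha>]) auto
  qed
  moreover have "lead_coeff q * e \<in> B" "lead_coeff q * e \<notin> P"
    using lB G(2,3) q(2) base.mult_mem prime_P B_sub by blast+
  ultimately show thesis using that by blast
qed

end

text \<open>The element \<open>c\<close> that \<open>choose_root\<close> provides for the generator adjoined last becomes the element not to be killed
  on the subring generated by the others. At the bottom of the induction, \<open>\<phi>\<^sub>0\<close> must be injective
  modulo \<open>P\<close>; the case of interest is \<open>B = k\<close>.\<close>

lemma (in prime_in) extend_point_finitely_generated: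
  fixes \<phi>\<^sub>0 :: "'a \<Rightarrow> 'k::{alg_closed_field, field_char_0}"
  assumes \<phi>\<^sub>0: "point_mod B P \<phi>\<^sub>0" and B: "B \<subseteq> C"
    and inj: "\<And>a. a \<in> B \<Longrightarrow> a \<notin> P \<Longrightarrow> \<phi>\<^sub>0 a \<noteq> 0"
    and ys: "set ys \<subseteq> C" and f: "f \<in> adjoin_list ys B" "f \<notin> P"
  shows "\<exists>\<phi>. point_mod (adjoin_list ys B) P \<phi> \<and> \<phi> f \<noteq> 0 \<and> (\<forall>a\<in>B. \<phi> a = \<phi>\<^sub>0 a)"
  using ys f
proof (induction ys arbitrary: f)
  case Nil
  then show ?case using \<phi>\<^sub>0 inj by auto
next
  case (Cons y ys)
  define A where "A = adjoin_list ys B"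
  have sub: "unital_subring (adjoin_list zs B) \<and> adjoin_list zs B \<subseteq> C \<and>
      B \<subseteq> adjoin_list zs B"
    if "set zs \<subseteq> C" for zs
    using that
  proof (induction zs)
    case Nil
    then show ?case using \<phi>\<^sub>0 B point_mod.axioms(1) by auto
  next
    case (Cons z zs)
    let ?D = "adjoin_list zs B"
    have D: "unital_subring ?D" "?D \<subseteq> C" "B \<subseteq> ?D" "z \<in> C" using Cons by auto
    have "adjoin ?D z \<subseteq> C"
      using D(4) polys_over_mono[OF D(2)] poly_eval_mem unfolding adjoin_def by blast
    then show ?case using D unital_subring.unital_subring_adjoin[OF D(1)]
        unital_subring.adjoin_base[OF D(1)] by auto
  qed
  have A: "unital_subring A" "A \<subseteq> C" "B \<subseteq> A" using sub[of ys] Cons.prems(1) unfolding A_def by auto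
  interpret simple_extension C P A y
    using A Cons.prems(1) by (intro simple_extension.intro simple_extension_axioms.intro prime_in_axioms) auto
  obtain F where F: "F \<in> polys_over A" "f = poly F y"
    using Cons.prems(2) unfolding A_def adjoin_def by auto
  obtain c where c: "c \<in> A" "c \<notin> P"
    "\<And>\<phi> :: 'a \<Rightarrow> 'k. point_mod A P \<phi> \<Longrightarrow> \<phi> c \<noteq> 0 \<Longrightarrow>
       \<exists>\<alpha>. (\<forall>h\<in>relations. poly (map_poly \<phi> h) \<alpha> = 0) \<and> poly (map_poly \<phi> F) \<alpha> \<noteq> 0"
    using choose_root[OF F(1), where 'k = 'k] Cons.prems(3) F(2) by blast
  obtain \<phi> where \<phi>: "point_mod A P \<phi>" "\<phi> c \<noteq> 0" "\<forall>a\<in>B. \<phi> a = \<phi>\<^sub>0 a"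
    using Cons.IH[of c] Cons.prems(1) c(1,2) unfolding A_def by auto
  obtain \<alpha> where \<alpha>: "\<And>h. h \<in> relations \<Longrightarrow> poly (map_poly \<phi> h) \<alpha> = 0" "poly (map_poly \<phi> F) \<alpha> \<noteq> 0"
    using c(3)[OF \<phi>(1,2)] by blast
  obtain \<psi> where \<psi>: "point_mod (adjoin A y) P \<psi>"
    "\<And>p. p \<in> polys_over A \<Longrightarrow> \<psi> (poly p y) = poly (map_poly \<phi> p) \<alpha>"
    using extend_point[OF \<phi>(1) \<alpha>(1)] by blast
  have "\<psi> a = \<phi>\<^sub>0 a" if "a \<in> B" for a
  proof -
    have "a \<in> A" using that A(3) by blast
    from \<psi>(2)[OF base.poly_const_mem[OF this]] show ?thesis
      using \<phi>(3) that point_mod.map_poly_constant[OF \<phi>(1)] by simp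
  qed
  then show ?case using \<psi> \<alpha>(2) F unfolding A_def[symmetric] by (auto simp: A_def[symmetric])
qed

section \<open>The Nullstellensatz for matrix coordinates\<close>

definition eval_monomial :: "'k::comm_ring_1 mat \<Rightarrow> (nat \<times> nat \<Rightarrow>\<^sub>0 nat) \<Rightarrow> 'k" where
  "eval_monomial w m = (\<Prod>ij \<in> Poly_Mapping.keys m. (w $$ ij) ^ Poly_Mapping.lookup m ij)"

lemma eval_monomial_add: "eval_monomial w (a + b) = eval_monomial w a * eval_monomial w b"
proof -
  let ?S = "Poly_Mapping.keys a \<union> Poly_Mapping.keys b"
  have *: "eval_monomial w m = (\<Prod>ij\<in>?S. (w $$ ij) ^ Poly_Mapping.lookup m ij)"
    if "Poly_Mapping.keys m \<subseteq> ?S" for m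
    unfolding eval_monomial_def using that
    by (intro prod.mono_neutral_left) (auto simp: in_keys_iff)
  show ?thesis
    using Poly_Mapping.keys_add[of a b]
    by (simp add: * lookup_add power_add prod.distrib)
qed

lemma eval_at_eq_sum:
  assumes "finite S" "Poly_Mapping.keys p \<subseteq> S"
  shows "eval_at w p = (\<Sum>m\<in>S. Poly_Mapping.lookup p m * eval_monomial w m)"
  unfolding eval_at_def eval_monomial_def using assms
  by (intro sum.mono_neutral_left) (auto simp: in_keys_iff)

lemma eval_at_add: "eval_at w (p + q) = eval_at w p + eval_at w q"
proof -
  let ?S = "Poly_Mapping.keys p \<union> Poly_Mapping.keys q"
  have "eval_at w (p + q) = (\<Sum>m\<in>?S. Poly_Mapping.lookup (p + q) m * eval_monomial w m)"
    using Poly_Mapping.keys_add[of p q] by (intro eval_at_eq_sum) auto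
  then show ?thesis
    by (simp add: eval_at_eq_sum[of ?S] lookup_add algebra_simps sum.distrib)
qed

lemma eval_at_single: "eval_at w (Poly_Mapping.single m c) = c * eval_monomial w m"
  by (subst eval_at_eq_sum[of "{m}"]) auto

lemma eval_at_zero: "eval_at w 0 = 0"
  by (simp add: eval_at_def)

lemma eval_at_sum: "eval_at w (sum f X) = (\<Sum>x\<in>X. eval_at w (f x))"
  by (induction X rule: infinite_finite_induct) (auto simp: eval_at_add eval_at_zero)

lemma poly_mapping_as_sum:
  "p = (\<Sum>m\<in>Poly_Mapping.keys p. Poly_Mapping.single m (Poly_Mapping.lookup p m))"
  by (intro poly_mapping_eqI) (auto simp: lookup_sum lookup_single when_def in_keys_iff)

lemma eval_at_mult: "eval_at w (p * q) = eval_at w p * eval_at w q"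
proof -
  have "p * q = (\<Sum>a\<in>Poly_Mapping.keys p. \<Sum>b\<in>Poly_Mapping.keys q.
      Poly_Mapping.single (a + b) (Poly_Mapping.lookup p a * Poly_Mapping.lookup q b))"
    by (subst poly_mapping_as_sum[of p], subst poly_mapping_as_sum[of q])
      (simp add: sum_product mult_single)
  then have "eval_at w (p * q) = (\<Sum>a\<in>Poly_Mapping.keys p. \<Sum>b\<in>Poly_Mapping.keys q.
      (Poly_Mapping.lookup p a * eval_monomial w a) * (Poly_Mapping.lookup q b * eval_monomial w b))"
    by (simp add: eval_at_sum eval_at_single eval_monomial_add ac_simps)
  then show ?thesis
    unfolding eval_at_eq_sum[OF finite_keys subset_refl, of w p]
      eval_at_eq_sum[OF finite_keys subset_refl, of w q] sum_product .
qed

interpretation eval: comm_ring_hom "eval_at w" for w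
  by unfold_locales
    (auto simp: eval_at_add eval_at_mult eval_at_zero eval_at_single eval_monomial_def simp flip: single_one)

lemma eval_at_const: "eval_at w (const c) = c"
  by (simp add: const_def eval_at_single eval_monomial_def)

lemma eval_at_var: "eval_at w (var ij) = w $$ ij"
  by (simp add: var_def eval_at_single eval_monomial_def)

lemma const_one: "const 1 = 1"
  and const_add: "const (a + b) = const a + const b"
  and const_uminus: "const (- a) = - const a"
  and const_mult: "const (a * b) = const a * const b"
  by (simp_all add: const_def single_add single_uminus mult_single)

lemma var_power: "var ij ^ e = Poly_Mapping.single (Poly_Mapping.single ij e) 1"
  by (induction e) (simp_all add: var_def mult_single single_add[symmetric])

lemma mpoly_as_sum:
  "p = (\<Sum>m\<in>Poly_Mapping.keys p. const (Poly_Mapping.lookup p m) *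
          (\<Prod>ij\<in>Poly_Mapping.keys m. var ij ^ Poly_Mapping.lookup m ij))"
proof -
  have prod: "(\<Prod>ij\<in>X. Poly_Mapping.single (f ij) 1) = Poly_Mapping.single (sum f X) (1::'a)"
    for X and f :: "nat \<times> nat \<Rightarrow> (nat \<times> nat \<Rightarrow>\<^sub>0 nat)"
    by (induction X rule: infinite_finite_induct) (simp_all add: mult_single)
  have "(\<Prod>ij\<in>Poly_Mapping.keys m. var ij ^ Poly_Mapping.lookup m ij) = Poly_Mapping.single m (1::'a)" for m
    unfolding var_power prod poly_mapping_as_sum[of m, symmetric] ..
  then show ?thesis
    using poly_mapping_as_sum[of p] by (simp add: const_def mult_single)
qed

lemma coord_ring_simps:
  "p \<oplus>\<^bsub>coord_ring r n\<^esub> q = p + q" "p \<otimes>\<^bsub>coord_ring r n\<^esub> q = p * q"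
  "\<one>\<^bsub>coord_ring r n\<^esub> = 1" "\<zero>\<^bsub>coord_ring r n\<^esub> = 0"
  by (simp_all add: coord_ring_def)

lemma coord_ring_pow: "f [^]\<^bsub>coord_ring r n\<^esub> (k::nat) = f ^ k"
  by (induction k) (simp_all add: coord_ring_simps mult.commute)

lemma unital_subring_coord_ring: "unital_subring (carrier (coord_ring r n :: 'k::comm_ring_1 mpoly2 ring))"
proof -
  interpret R: cring "coord_ring r n :: 'k mpoly2 ring" by (rule cring_coord_ring)
  show ?thesis
  proof
    fix a b :: "'k mpoly2" assume a: "a \<in> carrier (coord_ring r n)"
    show "- a \<in> carrier (coord_ring r n)" using a by (simp add: coord_ring_def)
    assume "b \<in> carrier (coord_ring r n)"
    then show "a + b \<in> carrier (coord_ring r n)" "a * b \<in> carrier (coord_ring r n)"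
      using a R.a_closed[of a b] R.m_closed[of a b] by (simp_all only: coord_ring_simps)
  qed (use R.one_closed in \<open>simp only: coord_ring_simps\<close>)
qed

lemma const_mem: "const c \<in> carrier (coord_ring r n)"
  and var_mem: "i < r \<Longrightarrow> j < n \<Longrightarrow> var (i, j) \<in> carrier (coord_ring r n)"
  by (auto simp: coord_ring_def const_def var_def split: if_splits)

lemma unital_subring_foldr_adjoin:
  "unital_subring B \<Longrightarrow> unital_subring (adjoin_list ys B)"
  by (induction ys) (auto intro: unital_subring.unital_subring_adjoin)

lemma foldr_adjoin_mem:
  assumes "unital_subring B" "a \<in> B \<or> a \<in> set ys"
  shows "a \<in> adjoin_list ys B"
  using assms(2)
proof (induction ys)
  case (Cons y ys)
  then show ?case
    using unital_subring.adjoin_base[OF unital_subring_foldr_adjoin[OF assms(1)]]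
      unital_subring.adjoin_generator[OF unital_subring_foldr_adjoin[OF assms(1)]] by auto
qed auto

lemma coord_ring_subset:
  fixes A :: "'a::comm_ring_1 mpoly2 set"
  assumes "unital_subring A" and const: "\<And>c. const c \<in> A"
    and var: "\<And>i j. i < r \<Longrightarrow> j < n \<Longrightarrow> var (i, j) \<in> A"
  shows "carrier (coord_ring r n) \<subseteq> A"
    and "\<And>(p :: 'a mpoly2) m. p \<in> carrier (coord_ring r n) \<Longrightarrow> m \<in> Poly_Mapping.keys p \<Longrightarrow>
      (\<Prod>ij\<in>Poly_Mapping.keys m. var ij ^ Poly_Mapping.lookup m ij) \<in> A"
proof -
  interpret A: unital_subring A by (rule assms(1))
  have prod_A: "prod g X \<in> A" if "\<And>x. x \<in> X \<Longrightarrow> g x \<in> A" for g :: "nat \<times> nat \<Rightarrow> 'a mpoly2" and X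
    using that by (induction X rule: infinite_finite_induct) (auto simp: A.one_mem A.mult_mem)
  have pow_A: "var ij ^ e \<in> A"
    if "p \<in> carrier (coord_ring r n)" "m \<in> Poly_Mapping.keys p" "ij \<in> Poly_Mapping.keys m"
    for p :: "'a mpoly2" and m ij e
  proof -
    have "ij \<in> {..<r} \<times> {..<n}" using that unfolding coord_ring_def by auto
    then show ?thesis using var A.power_mem by (cases ij) auto
  qed
  show prods: "(\<Prod>ij\<in>Poly_Mapping.keys m. var ij ^ Poly_Mapping.lookup m ij) \<in> A"
    if "p \<in> carrier (coord_ring r n)" "m \<in> Poly_Mapping.keys p" for p :: "'a mpoly2" and m
    by (rule prod_A[OF pow_A[OF that]])
  show "carrier (coord_ring r n) \<subseteq> A"
  proof
    fix p :: "'a mpoly2" assume p: "p \<in> carrier (coord_ring r n)"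
    show "p \<in> A"
      by (subst mpoly_as_sum) (intro A.sum_mem A.mult_mem const prods[OF p])
  qed
qed

text \<open>A homomorphism of \<open>k\<close>-algebras is determined by the images of the variables, which are the
  coordinates of the point.\<close>

lemma point_mod_is_evaluation:
  assumes "point_mod A P \<phi>" and const: "\<And>c. const c \<in> A" "\<And>c. \<phi> (const c) = c"
    and var: "\<And>i j. i < r \<Longrightarrow> j < n \<Longrightarrow> var (i, j) \<in> A"
    and p: "p \<in> carrier (coord_ring r n)"
  shows "\<phi> p = eval_at (mat r n (\<lambda>ij. \<phi> (var ij))) p" (is "_ = eval_at ?w p")
proof -
  interpret point_mod A P \<phi> by (rule assms(1))
  let ?mon = "\<lambda>m. \<Prod>ij\<in>Poly_Mapping.keys m. var ij ^ Poly_Mapping.lookup m ij"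
  have mon_A: "?mon m \<in> A" if "m \<in> Poly_Mapping.keys p" for m
    using coord_ring_subset(2)[OF base.unital_subring_axioms const(1) var p that] .
  have "\<phi> (const (Poly_Mapping.lookup p m) * ?mon m) =
      Poly_Mapping.lookup p m * (\<Prod>ij\<in>Poly_Mapping.keys m. (?w $$ ij) ^ Poly_Mapping.lookup m ij)"
    if m: "m \<in> Poly_Mapping.keys p" for m
  proof -
    have ij: "var ij \<in> A \<and> \<phi> (var ij) = ?w $$ ij" if "ij \<in> Poly_Mapping.keys m" for ij
    proof -
      have "ij \<in> {..<r} \<times> {..<n}" using p m that unfolding coord_ring_def by auto
      then show ?thesis using var by (cases ij) auto
    qed
    have "\<phi> (?mon m) = (\<Prod>ij\<in>Poly_Mapping.keys m. \<phi> (var ij ^ Poly_Mapping.lookup m ij))"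
      by (rule conjunct2[OF map_prod]) (use base.power_mem ij in simp)
    also have "\<dots> = (\<Prod>ij\<in>Poly_Mapping.keys m. (?w $$ ij) ^ Poly_Mapping.lookup m ij)"
      using ij by (intro prod.cong) (simp_all add: map_power)
    finally show ?thesis using const map_mult[OF const(1) mon_A[OF m]] by simp
  qed
  moreover have "\<phi> p = (\<Sum>m\<in>Poly_Mapping.keys p. \<phi> (const (Poly_Mapping.lookup p m) * ?mon m))"
    by (rule trans[OF arg_cong[where f = \<phi>, OF mpoly_as_sum] map_sum])
      (rule base.mult_mem[OF const(1) mon_A])
  ultimately show ?thesis by (simp add: eval_at_def)
qed

text \<open>The coordinate ring arises from the field by adjoining finitely many variables, so the evaluation
  homomorphism on constants extends to it modulo \<open>P\<close> without killing \<open>f\<close>.\<close>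

theorem prime_ideal_point:
  fixes f :: "'k::{alg_closed_field, field_char_0} mpoly2"
  assumes P: "primeideal P (coord_ring r n)" and f: "f \<in> carrier (coord_ring r n)" "f \<notin> P"
  shows "\<exists>w\<in>carrier_mat r n. (\<forall>p\<in>P. eval_at w p = 0) \<and> eval_at w f \<noteq> 0"
proof -
  let ?R = "coord_ring r n :: 'k mpoly2 ring"
  let ?C = "carrier ?R"
  interpret P: primeideal P ?R by (rule P)
  interpret C: unital_subring ?C by (rule unital_subring_coord_ring)
  interpret prime_in ?C P
  proof
    show "P \<subseteq> ?C" by (rule P.a_subset)
    show "0 \<in> P"
      using additive_subgroup.zero_closed[OF P.additive_subgroup_axioms] by (simp add: coord_ring_simps)
    show "1 \<notin> P"
      using P.I_notcarr P.I_r_closed[of 1] P.a_subset by (auto simp: coord_ring_simps)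
    show "a + b \<in> P" if "a \<in> P" "b \<in> P" for a b
      using additive_subgroup.a_closed[OF P.additive_subgroup_axioms that] by (simp add: coord_ring_simps)
    show "a * b \<in> P" if "a \<in> ?C" "b \<in> P" for a b
      using P.I_l_closed[OF that(2,1)] by (simp add: coord_ring_simps)
    show "a \<in> P \<or> b \<in> P" if "a \<in> ?C" "b \<in> ?C" "a * b \<in> P" for a b
      using P.I_prime[OF that(1,2)] that(3) by (simp add: coord_ring_simps)
  qed
  define B :: "'k mpoly2 set" where "B = range const"
  define vars :: "'k mpoly2 list" where "vars = map var (List.product [0..<r] [0..<n])"
  define A :: "'k mpoly2 set" where "A = adjoin_list vars B"
  \<comment> \<open>On constants, the evaluation at any matrix is the identity; the zero matrix is an arbitrary choice.\<close>
  define \<phi>\<^sub>0 :: "'k mpoly2 \<Rightarrow> 'k" where "\<phi>\<^sub>0 p = eval_at (0\<^sub>m r n) p" for p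
  have \<phi>\<^sub>0_const: "\<phi>\<^sub>0 (const c) = c" for c by (simp add: \<phi>\<^sub>0_def eval_at_const)
  have constP: "c = 0" if "const c \<in> P" for c :: 'k
  proof (rule ccontr)
    assume "c \<noteq> 0"
    then have "const (1 / c) * const c = (1 :: 'k mpoly2)" by (simp add: const_mult[symmetric] const_one)
    then show False using mult_P[OF const_mem[of "1 / c"] that] one_P by simp
  qed
  have B: "unital_subring B"
    unfolding B_def
    by unfold_locales (auto simp: const_one[symmetric] const_add[symmetric] const_mult[symmetric]
        const_uminus[symmetric])
  have pt: "point_mod B P \<phi>\<^sub>0"
    using B
    by (intro point_mod.intro point_mod_axioms.intro)
      (auto simp: \<phi>\<^sub>0_def eval.hom_add eval.hom_mult B_def eval_at_const dest: constP)
  have A_sub: "unital_subring A" unfolding A_def by (rule unital_subring_foldr_adjoin[OF B])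
  interpret A: unital_subring A by (rule A_sub)
  have const_A: "const c \<in> A" for c unfolding A_def B_def
    by (rule foldr_adjoin_mem[OF B[unfolded B_def]]) auto
  have var_A: "var (i, j) \<in> A" if "i < r" "j < n" for i j
    unfolding A_def by (rule foldr_adjoin_mem[OF B]) (use that in \<open>auto simp: vars_def\<close>)
  have C_A: "?C \<subseteq> A" by (rule coord_ring_subset[OF A_sub const_A var_A])
  have "\<exists>\<phi>. point_mod A P \<phi> \<and> \<phi> f \<noteq> 0 \<and> (\<forall>a\<in>B. \<phi> a = \<phi>\<^sub>0 a)"
    unfolding A_def
  proof (rule extend_point_finitely_generated[OF pt])
    show "B \<subseteq> ?C" unfolding B_def using const_mem by blast
    show "\<phi>\<^sub>0 a \<noteq> 0" if "a \<in> B" "a \<notin> P" for a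
      using that zero_P \<phi>\<^sub>0_const unfolding B_def by (auto simp: const_def)
    show "set vars \<subseteq> ?C" unfolding vars_def using var_mem by auto
    show "f \<in> adjoin_list vars B" using C_A f(1) unfolding A_def by blast
  qed (rule f(2))
  then obtain \<phi> where \<phi>: "point_mod A P \<phi>" "\<phi> f \<noteq> 0" "\<forall>a\<in>B. \<phi> a = \<phi>\<^sub>0 a"
    by (elim exE conjE) (rule that)
  have const: "\<phi> (const c) = c" for c
    using \<phi>(3) \<phi>\<^sub>0_const[of c] unfolding B_def by (metis rangeI)
  define w where "w = mat r n (\<lambda>ij. \<phi> (var ij))"
  have eval: "\<phi> p = eval_at w p" if "p \<in> ?C" for p
    unfolding w_def by (rule point_mod_is_evaluation[OF \<phi>(1) const_A const var_A that])
  have "eval_at w p = 0" if "p \<in> P" for p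
    using that P.a_subset C_A eval point_mod.map_P[OF \<phi>(1)] by (metis subsetD)
  moreover have "eval_at w f \<noteq> 0" using \<phi>(2) eval[OF f(1)] by simp
  moreover have "w \<in> carrier_mat r n" by (simp add: w_def)
  ultimately show ?thesis by blast
qed

text \<open>The radical is the intersection of the prime ideals that contain \<open>I\<close>, and by \<open>prime_ideal_point\<close>
  every element outside such a prime ideal is nonzero at one of its zeros.\<close>

theorem nullstellensatz:
  fixes I :: "'k::{alg_closed_field, field_char_0} mpoly2 set"
  assumes I: "ideal I (coord_ring r n)"
  shows "radical (coord_ring r n) I = vanishing_ideal r n (zero_locus r n I)"
proof (intro equalityI subsetI)
  fix f assume f: "f \<in> radical (coord_ring r n) I"
  then obtain k where "f ^ k \<in> I" "f \<in> carrier (coord_ring r n)"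
    unfolding radical_def coord_ring_pow by blast
  moreover have "eval_at w f = 0" if "w \<in> zero_locus r n I" for w
  proof -
    have "eval_at w (f ^ k) = 0" using that \<open>f ^ k \<in> I\<close> unfolding zero_locus_def by blast
    then show ?thesis by (simp add: eval.hom_power)
  qed
  ultimately show "f \<in> vanishing_ideal r n (zero_locus r n I)"
    unfolding vanishing_ideal_def by blast
next
  fix f assume f: "f \<in> vanishing_ideal r n (zero_locus r n I)"
  then have fC: "f \<in> carrier (coord_ring r n)" unfolding vanishing_ideal_def by blast
  show "f \<in> radical (coord_ring r n) I"
  proof (rule ccontr)
    assume "f \<notin> radical (coord_ring r n) I"
    then have "\<And>k::nat. f [^]\<^bsub>coord_ring r n\<^esub> k \<notin> I" using fC unfolding radical_def by blast
    then obtain P where P: "primeideal P (coord_ring r n)" "I \<subseteq> P" "f \<notin> P"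
      using exists_prime_ideal_avoiding[OF cring_coord_ring I fC] by blast
    obtain w where "w \<in> carrier_mat r n" "\<forall>p\<in>P. eval_at w p = 0" "eval_at w f \<noteq> 0"
      using prime_ideal_point[OF P(1) fC P(3)] by blast
    then show False using f P(2) unfolding vanishing_ideal_def zero_locus_def by blast
  qed
qed

section \<open>Systems of linear equations and minors\<close>

text \<open>A linear functional that vanishes on the common kernel of finitely many functionals is a combination
  of them. If \<open>M i0\<close> vanishes on the common kernel of the others it can be left out. Otherwise it is nonzero
  at some \<open>z1\<close> in this kernel, and the induction hypothesis applies to \<open>u - c M i0\<close>, where \<open>c\<close> makes
  the difference vanish at \<open>z1\<close>: every \<open>z\<close> in the kernel is the sum of a multiple of \<open>z1\<close> and a vector that
  \<open>M i0\<close> kills as well.\<close>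

lemma functional_in_span:
  fixes M :: "'i \<Rightarrow> 'b \<Rightarrow> 'k::field"
  assumes "finite I" and X: "finite X"
    and "\<And>z. (\<And>i. i \<in> I \<Longrightarrow> (\<Sum>b\<in>X. M i b * z b) = 0) \<Longrightarrow> (\<Sum>b\<in>X. u b * z b) = 0"
  shows "\<exists>a. \<forall>b\<in>X. u b = (\<Sum>i\<in>I. a i * M i b)"
  using assms(1,3)
proof (induction I arbitrary: u rule: finite_induct)
  case empty
  have "u b = 0" if "b \<in> X" for b
    using empty[of "\<lambda>c. if c = b then 1 else 0"] that X by (simp add: if_distrib cong: if_cong)
  then show ?case by simp
next
  case (insert i0 I)
  show ?case
  proof (cases "\<forall>z. (\<forall>i\<in>I. (\<Sum>b\<in>X. M i b * z b) = 0) \<longrightarrow> (\<Sum>b\<in>X. M i0 b * z b) = 0")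
    case True
    have "\<exists>a. \<forall>b\<in>X. u b = (\<Sum>i\<in>I. a i * M i b)"
      using True insert.prems by (intro insert.IH) blast
    then obtain a where a: "\<forall>b\<in>X. u b = (\<Sum>i\<in>I. a i * M i b)" by blast
    have "(\<Sum>i\<in>insert i0 I. (a(i0 := 0)) i * M i b) = (\<Sum>i\<in>I. a i * M i b)" for b
      using insert.hyps by (auto intro: sum.cong)
    then show ?thesis using a by metis
  next
    case False
    then obtain z1 where z1: "\<And>i. i \<in> I \<Longrightarrow> (\<Sum>b\<in>X. M i b * z1 b) = 0" "(\<Sum>b\<in>X. M i0 b * z1 b) \<noteq> 0"
      by blast
    define d where "d = (\<Sum>b\<in>X. M i0 b * z1 b)"
    define c where "c = (\<Sum>b\<in>X. u b * z1 b) / d"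
    have "\<exists>a. \<forall>b\<in>X. u b - c * M i0 b = (\<Sum>i\<in>I. a i * M i b)"
    proof (rule insert.IH)
      fix z assume z: "\<And>i. i \<in> I \<Longrightarrow> (\<Sum>b\<in>X. M i b * z b) = 0"
      \<comment> \<open>The choice of \<open>e\<close> makes \<open>M i0\<close> kill \<open>z - e z1\<close>.\<close>
      define e where "e = (\<Sum>b\<in>X. M i0 b * z b) / d"
      have lin: "(\<Sum>b\<in>X. g b * (z b - e * z1 b)) = (\<Sum>b\<in>X. g b * z b) - e * (\<Sum>b\<in>X. g b * z1 b)" for g
        by (simp add: sum_subtractf sum_distrib_left algebra_simps)
      have "(\<Sum>b\<in>X. u b * (z b - e * z1 b)) = 0"
      proof (rule insert.prems)
        fix i assume "i \<in> insert i0 I"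
        then show "(\<Sum>b\<in>X. M i b * (z b - e * z1 b)) = 0"
          unfolding lin using z z1 by (auto simp: e_def d_def)
      qed
      then have "(\<Sum>b\<in>X. u b * z b) = c * (\<Sum>b\<in>X. M i0 b * z b)"
        using z1(2) unfolding lin by (simp add: c_def e_def d_def)
      then show "(\<Sum>b\<in>X. (u b - c * M i0 b) * z b) = 0"
        by (simp add: sum_subtractf sum_distrib_left algebra_simps)
    qed
    then obtain a where a: "\<forall>b\<in>X. u b - c * M i0 b = (\<Sum>i\<in>I. a i * M i b)" by blast
    have "(\<Sum>i\<in>insert i0 I. (a(i0 := c)) i * M i b) = c * M i0 b + (\<Sum>i\<in>I. a i * M i b)" for b
      using insert.hyps by (auto intro: sum.cong)
    then have "\<forall>b\<in>X. u b = (\<Sum>i\<in>insert i0 I. (a(i0 := c)) i * M i b)"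
      using a by (metis add.commute diff_add_cancel)
    then show ?thesis by blast
  qed
qed

text \<open>Padding the system with zero rows gives a singular square matrix.\<close>

lemma underdetermined_system:
  fixes M :: "'i \<Rightarrow> nat \<Rightarrow> 'k::field"
  assumes "finite I" "card I < l"
  obtains t where "\<exists>b<l. t b \<noteq> 0" "\<And>i. i \<in> I \<Longrightarrow> (\<Sum>b<l. M i b * t b) = 0"
proof -
  obtain h where h: "bij_betw h {0..<card I} I" using ex_bij_betw_nat_finite[OF assms(1)] by blast
  define A where "A = mat l l (\<lambda>(a, b). if a < card I then M (h a) b else 0)"
  have A: "A \<in> carrier_mat l l" by (simp add: A_def)
  have "transpose_mat A *\<^sub>v unit_vec l (l - 1) = 0\<^sub>v l"
    using assms(2) by (intro eq_vecI) (auto simp: A_def)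
  then have "det (transpose_mat A) = 0"
    using assms(2) A by (subst det_0_iff_vec_prod_zero_field[of _ l])
      (auto intro!: exI[of _ "unit_vec l (l - 1)"] simp: unit_vec_nonzero)
  then obtain v where v: "v \<in> carrier_vec l" "v \<noteq> 0\<^sub>v l" "A *\<^sub>v v = 0\<^sub>v l"
    using det_transpose[OF A] det_0_iff_vec_prod_zero_field[OF A] by auto
  show thesis
  proof
    show "\<exists>b<l. v $ b \<noteq> 0" using v(1,2) by (metis carrier_vecD eq_vecI index_zero_vec)
    fix i assume "i \<in> I"
    then obtain a where a: "i = h a" "a < card I" 
    using h unfolding bij_betw_def by (metis atLeast0LessThan imageE lessThan_iff)
    have "(A *\<^sub>v v) $ a = (\<Sum>b<l. M i b * v $ b)"
      using a v(1) assms(2) by (auto simp: A_def scalar_prod_def lessThan_atLeast0 intro: sum.cong)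
    then show "(\<Sum>b<l. M i b * v $ b) = 0" using v(3) a(2) assms(2) by simp
  qed
qed

lemma pick_lessThan: "b < l \<Longrightarrow> pick {..<l} b = b"
proof -
  assume b: "b < l"
  then have "{a \<in> {..<l}. a < b} = {..<b}" by auto
  then show ?thesis using pick_card_in_set[of b "{..<l}"] b by simp
qed

lemma bij_betw_pick:
  assumes "finite I"
  shows "bij_betw (pick I) {..<card I} I"
proof -
  have "inj_on (pick I) {..<card I}"
    
    by (rule linorder_inj_onI) (metis lessThan_iff less_irrefl pick_mono, linarith)
  moreover have "pick I ` {..<card I} \<subseteq> I" by (auto intro: pick_in_set)
  ultimately show ?thesis
    using assms card_image[of "pick I" "{..<card I}"] card_subset_eq[OF assms]
    unfolding bij_betw_def by auto
qed

text \<open>Let \<open>I\<close> be a maximal set of indices of linearly independent rows. If \<open>I\<close> had at least \<open>l\<close> elements, some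
  \<open>l\<close> of these rows would form a nonzero minor. So \<open>I\<close> is smaller, and the equations given by the rows in
  \<open>I\<close> have a nonzero solution \<open>t\<close>. The remaining rows depend on those in \<open>I\<close>, so \<open>t\<close> solves their
  equations too.\<close>

lemma kernel_if_minors_vanish:
  fixes M :: "'k::field mat"
  assumes M: "M \<in> carrier_mat m l"
    and minors: "\<And>I. I \<subseteq> {..<m} \<Longrightarrow> card I = l \<Longrightarrow> det (submatrix M I {..<l}) = 0"
  obtains t where "\<exists>b<l. t b \<noteq> 0" "\<And>i. i < m \<Longrightarrow> (\<Sum>b<l. M $$ (i, b) * t b) = 0"
proof -
  define indep where "indep I \<longleftrightarrow>
    (\<forall>s. (\<forall>b<l. (\<Sum>i\<in>I. s i * M $$ (i, b)) = 0) \<longrightarrow> (\<forall>i\<in>I. s i = 0))" for I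
  have "finite (card ` {I. I \<subseteq> {..<m} \<and> indep I})" by simp
  moreover have "{} \<in> {I. I \<subseteq> {..<m} \<and> indep I}" by (simp add: indep_def)
  ultimately obtain I where I: "I \<subseteq> {..<m}" "indep I"
      and max: "\<And>K. K \<subseteq> {..<m} \<Longrightarrow> indep K \<Longrightarrow> card K \<le> card I"
    using Max_in[of "card ` {I. I \<subseteq> {..<m} \<and> indep I}"] Max_ge[of "card ` {I. I \<subseteq> {..<m} \<and> indep I}"]
    by (smt (verit) empty_iff image_iff mem_Collect_eq)
  have fin: "finite I" using I(1) finite_subset by blast
  have "card I < l"
  proof (rule ccontr)
    assume "\<not> card I < l"
    then obtain K where K: "K \<subseteq> I" "card K = l"
      using obtain_subset_with_card_n[of l I] by auto
    have finK: "finite K" using K(1) fin finite_subset by blast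
    have indK: "\<forall>i\<in>K. s i = 0" if s: "\<forall>b<l. (\<Sum>i\<in>K. s i * M $$ (i, b)) = 0" for s
    proof -
      define s' where "s' i = (if i \<in> K then s i else 0)" for i
      have "(\<Sum>i\<in>I. s' i * M $$ (i, b)) = (\<Sum>i\<in>K. s i * M $$ (i, b))" for b
        using K(1) fin by (intro sum.mono_neutral_cong_right) (auto simp: s'_def)
      then have "\<forall>i\<in>I. s' i = 0" using I(2) s unfolding indep_def by simp
      then show ?thesis using K(1) unfolding s'_def by (metis subsetD)
    qed
    define A where "A = submatrix M K {..<l}"
    have rows: "{i. i < m \<and> i \<in> K} = K" using K(1) I(1) by auto
    have cols: "{j. j < l \<and> j \<in> {..<l}} = {..<l}" by auto
    have A: "A \<in> carrier_mat l l"
      using M K(2) unfolding A_def by (intro carrier_matI) (simp_all add: dim_submatrix rows)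
    have A_idx: "A $$ (a, b) = M $$ (pick K a, b)" if "a < l" "b < l" for a b
      unfolding A_def using that M K(2) by (subst submatrix_index) (auto simp: rows pick_lessThan)
    have "det A = 0" unfolding A_def using minors[of K] K I(1) by auto
    then obtain v where v: "v \<in> carrier_vec l" "v \<noteq> 0\<^sub>v l" "transpose_mat A *\<^sub>v v = 0\<^sub>v l"
      using det_transpose[OF A] det_0_iff_vec_prod_zero_field[of "transpose_mat A" l] A by auto
    define s where "s i = v $ (the_inv_into {..<l} (pick K) i)" for i
    have bij: "bij_betw (pick K) {..<l} K" using bij_betw_pick[OF finK] K(2) by simp
    have s_pick: "s (pick K a) = v $ a" if "a < l" for a
      unfolding s_def using bij that by (simp add: bij_betw_def the_inv_into_f_f)
    have "(\<Sum>i\<in>K. s i * M $$ (i, b)) = 0" if b: "b < l" for b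
    proof -
      have "(\<Sum>i\<in>K. s i * M $$ (i, b)) = (\<Sum>a<l. s (pick K a) * M $$ (pick K a, b))"
        using sum.reindex_bij_betw[OF bij, of "\<lambda>i. s i * M $$ (i, b)"] by simp
      also have "\<dots> = (transpose_mat A *\<^sub>v v) $ b"
        using A v(1) b by (auto simp: scalar_prod_def lessThan_atLeast0 A_idx[unfolded lessThan_atLeast0] s_pick intro!: sum.cong)
      finally show ?thesis using v(3) b by simp
    qed
    then have "\<forall>i\<in>K. s i = 0" using indK by blast
    then have "\<forall>a<l. v $ a = 0" using s_pick bij unfolding bij_betw_def by (metis imageI lessThan_iff)
    then show False using v(1,2) by (metis carrier_vecD eq_vecI index_zero_vec)
  qed
  then obtain t where t: "\<exists>b<l. t b \<noteq> 0" "\<And>i. i \<in> I \<Longrightarrow> (\<Sum>b<l. M $$ (i, b) * t b) = 0"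
    using underdetermined_system[OF fin, of l "\<lambda>i b. M $$ (i, b)"] by blast
  have "(\<Sum>b<l. M $$ (i, b) * t b) = 0" if i: "i < m" for i
  proof (cases "i \<in> I")
    case False
    then have "card (insert i I) > card I" using fin by simp
    then have "\<not> indep (insert i I)" using max[of "insert i I"] I(1) i by auto
    then obtain s k where s: "\<And>b. b < l \<Longrightarrow> (\<Sum>i\<in>insert i I. s i * M $$ (i, b)) = 0"
        "k \<in> insert i I" "s k \<noteq> 0"
      unfolding indep_def by blast
    have eq: "s i * M $$ (i, b) = - (\<Sum>k\<in>I. s k * M $$ (k, b))" if "b < l" for b
      using s(1)[OF that] False fin by (simp add: eq_neg_iff_add_eq_0)
    have "s i \<noteq> 0"
    proof
      assume 0: "s i = 0"
      then have "\<forall>k\<in>I. s k = 0" using eq I(2) unfolding indep_def by simp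
      then show False using s(2,3) 0 by auto
    qed
    have "s i * (\<Sum>b<l. M $$ (i, b) * t b) = (\<Sum>b<l. (s i * M $$ (i, b)) * t b)"
      by (simp add: sum_distrib_left mult.assoc)
    also have "\<dots> = - (\<Sum>b<l. \<Sum>k\<in>I. s k * (M $$ (k, b) * t b))"
      by (simp add: eq sum_distrib_right sum_negf mult.assoc)
    also have "\<dots> = - (\<Sum>k\<in>I. s k * (\<Sum>b<l. M $$ (k, b) * t b))"
      by (subst sum.swap) (simp add: sum_distrib_left)
    also have "\<dots> = 0" using t(2) by simp
    finally show ?thesis using \<open>s i \<noteq> 0\<close> by simp
  qed (rule t(2))
  then show thesis using t(1) that by blast
qed

lemma minors_vanish_if_kernel:
  fixes M :: "'k::field mat"
  assumes M: "M \<in> carrier_mat m l"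
    and t: "\<exists>b<l. t b \<noteq> 0" "\<And>i. i < m \<Longrightarrow> (\<Sum>b<l. M $$ (i, b) * t b) = 0"
    and I: "I \<subseteq> {..<m}" "card I = l"
  shows "det (submatrix M I {..<l}) = 0"
proof -
  let ?A = "submatrix M I {..<l}"
  have rows: "{i. i < m \<and> i \<in> I} = I" using I(1) by auto
  have A: "?A \<in> carrier_mat l l"
    using M I(2) by (intro carrier_matI) (simp_all add: dim_submatrix rows)
  have A_idx: "?A $$ (a, b) = M $$ (pick I a, b)" if "a < l" "b < l" for a b
    using that M I(2) by (subst submatrix_index) (auto simp: rows pick_lessThan)
  have "?A *\<^sub>v vec l t = 0\<^sub>v l"
  proof (rule eq_vecI)
    fix a assume "a < dim_vec (0\<^sub>v l :: 'k vec)"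
    then have a: "a < l" by simp
    have "pick I a < m" using pick_in_set[of a I] a I by auto
    moreover have "(?A *\<^sub>v vec l t) $ a = (\<Sum>b<l. M $$ (pick I a, b) * t b)"
      using A a by (auto simp: scalar_prod_def lessThan_atLeast0 A_idx[unfolded lessThan_atLeast0] intro!: sum.cong)
    ultimately show "(?A *\<^sub>v vec l t) $ a = 0\<^sub>v l $ a" using t(2) a by simp
  qed (use A in simp)
  moreover have "vec l t \<noteq> 0\<^sub>v l" using t(1) by (metis index_vec index_zero_vec(1))
  ultimately show ?thesis
    unfolding det_0_iff_vec_prod_zero_field[OF A] by (intro exI[of _ "vec l t"]) simp
qed

section \<open>The vanishing of the minors at a matrix\<close>

lemma is_perp_in_kernel:
  assumes "is_perp V P" "b < dim_row P" "i < dim_row V"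
  shows "(\<Sum>c<dim_col V. V $$ (i, c) * P $$ (b, c)) = 0"
proof -
  interpret k: kernel "dim_row V" "dim_col V" V by unfold_locales simp
  have P: "dim_col P = dim_col V" "k.basis (set (rows P))" using assms(1) unfolding is_perp_def by auto
  have "row P b \<in> set (rows P)" using assms(2) by (auto simp: rows_def)
  then have "row P b \<in> mat_kernel V" using P(2) unfolding k.Ker.basis_def by auto
  then have "(V *\<^sub>v row P b) $ i = 0" using assms(3) by (auto simp: mat_kernel_def)
  then show ?thesis
    using assms(2,3) P(1) by (simp add: scalar_prod_def lessThan_atLeast0)
qed

text \<open>The vectors orthogonal to \<open>u\<close> form a subspace, so it contains the kernel of \<open>V\<close> as soon as it contains
  the basis formed by the rows of \<open>P\<close>.\<close>

lemma is_perp_spans_kernel: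
  assumes perp: "is_perp V P"
    and u: "\<And>b. b < dim_row P \<Longrightarrow> (\<Sum>c<dim_col V. P $$ (b, c) * u c) = 0"
    and z: "\<And>i. i < dim_row V \<Longrightarrow> (\<Sum>c<dim_col V. V $$ (i, c) * z c) = 0"
  shows "(\<Sum>c<dim_col V. u c * z c) = 0"
proof -
  let ?l = "dim_col V"
  interpret k: kernel "dim_row V" ?l V by unfold_locales simp
  have P: "dim_col P = ?l" "k.basis (set (rows P))" using perp unfolding is_perp_def by auto
  define K where "K = {x \<in> mat_kernel V. vec ?l u \<bullet> x = 0}"
  have carr: "x \<in> carrier_vec ?l" if "x \<in> mat_kernel V" for x
    using that by (simp add: mat_kernel_def)
  have "submodule class_ring K k.VK"
  proof (unfold_locales)
    show "K \<subseteq> carrier k.VK" by (auto simp: K_def)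
    show "x \<oplus>\<^bsub>k.VK\<^esub> y \<in> K" if "x \<in> K" "y \<in> K" for x y
      using that k.Ker.M.a_closed[of x y] carr by (auto simp: K_def scalar_prod_add_distrib[of _ ?l])
    show "\<zero>\<^bsub>k.VK\<^esub> \<in> K" using k.Ker.M.zero_closed by (auto simp: K_def)
    show "c \<odot>\<^bsub>k.VK\<^esub> x \<in> K" if "c \<in> carrier class_ring" "x \<in> K" for c x
      using that k.Ker.smult_closed[of c x] carr by (auto simp: K_def)
  qed
  moreover have "set (rows P) \<subseteq> K"
  proof
    fix x assume x: "x \<in> set (rows P)"
    then obtain b where b: "x = row P b" "b < dim_row P" by (auto simp: rows_def)
    have "vec ?l u \<bullet> x = (\<Sum>c<?l. P $$ (b, c) * u c)"
      using b P(1) by (auto simp: scalar_prod_def lessThan_atLeast0 mult.commute intro!: sum.cong)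
    then show "x \<in> K" using x P(2) u[OF b(2)] unfolding K_def k.Ker.basis_def by auto
  qed
  ultimately have "mat_kernel V \<subseteq> K"
    using k.Ker.span_is_subset[of "set (rows P)" K] P(2) unfolding k.Ker.basis_def by auto
  moreover have "vec ?l z \<in> mat_kernel V"
    using z by (intro mat_kernelI[of V "dim_row V" ?l] eq_vecI)
      (auto simp: scalar_prod_def lessThan_atLeast0)
  ultimately have "vec ?l u \<bullet> vec ?l z = 0" unfolding K_def by blast
  then show ?thesis by (simp add: scalar_prod_def lessThan_atLeast0)
qed

lemma row_index_less: "a < r \<Longrightarrow> c < d \<Longrightarrow> a * d + c < r * (d :: nat)"
  using mult_le_mono1[of "Suc a" r d] by simp

lemma submatrix_map_mat: "submatrix (map_mat f M) I K = map_mat f (submatrix M I K)"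
  by (intro eq_matI) (auto simp: dim_submatrix submatrix_index pick_le)

lemma cols_submatrix_carrier:
  "A \<in> carrier_mat r n \<Longrightarrow> J \<subseteq> {..<n} \<Longrightarrow> cols_submatrix A J \<in> carrier_mat r (card J)"
proof -
  assume "A \<in> carrier_mat r n" "J \<subseteq> {..<n}"
  moreover from this have "{j. j < n \<and> j \<in> J} = J" by auto
  ultimately show ?thesis by (intro carrier_matI) (simp_all add: cols_submatrix_def dim_submatrix)
qed

lemma cols_submatrix_index:
  assumes "A \<in> carrier_mat r n" "J \<subseteq> {..<n}" "i < r" "b < card J"
  shows "cols_submatrix A J $$ (i, b) = A $$ (i, pick J b)"
proof -
  have "{j. j < n \<and> j \<in> J} = J" using assms(2) by auto
  then show ?thesis
    using assms unfolding cols_submatrix_def by (subst submatrix_index) (simp_all add: pick_UNIV)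
qed

lemma eval_col_tensor:
  fixes w P :: "'k::comm_ring_1 mat"
  assumes w: "w \<in> carrier_mat r n" and J: "J \<subseteq> {..<n}" and P: "dim_col P = card J"
  shows "map_mat (eval_at w) (col_tensor (cols_submatrix (generic_matrix r n) J) (map_mat const P)) =
    col_tensor (cols_submatrix w J) P" (is "map_mat _ ?L = ?R")
proof -
  have g: "(generic_matrix r n :: 'k mpoly2 mat) \<in> carrier_mat r n" by (simp add: generic_matrix_def)
  note cg = cols_submatrix_carrier[OF g J] and cw = cols_submatrix_carrier[OF w J]
  show ?thesis
  proof (rule eq_matI)
    fix i b assume "i < dim_row ?R" "b < dim_col ?R"
    then have ib: "i < r * dim_row P" "b < card J" using cw by (auto simp: col_tensor_def)
    then have "dim_row P > 0" by (cases "dim_row P") auto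
    moreover have a: "i div dim_row P < r" using ib(1) by (simp add: less_mult_imp_div_less)
    moreover have "pick J b < n" using pick_in_set[of b J] ib(2) J by auto
    moreover from this a have "eval_at w ((generic_matrix r n :: 'k mpoly2 mat) $$ (i div dim_row P, pick J b)) =
        w $$ (i div dim_row P, pick J b)"
      by (simp add: generic_matrix_def eval_at_var)
    ultimately show "map_mat (eval_at w) ?L $$ (i, b) = ?R $$ (i, b)"
      using ib carrier_matD[OF cg] carrier_matD[OF cw] P
      by (simp add: col_tensor_def cols_submatrix_index[OF g J a ib(2)] cols_submatrix_index[OF w J a ib(2)]
          eval.hom_mult eval_at_const)
  qed (use cg cw in \<open>auto simp: col_tensor_def\<close>)
qed

text \<open>The minors of full size \<open>|J|\<close> vanish if and only if the columns of \<open>w\<^sub>J \<odot> P\<close> have a nontrivial relation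
  \<open>t\<close>. Its coordinates state that each row of \<open>w\<^sub>J diag(t)\<close> is orthogonal to each row of \<open>P\<close>. As these
  span the kernel of \<open>v\<^sub>J\<close>, this means that each row of \<open>w\<^sub>J diag(t)\<close> is a combination of the rows of
  \<open>v\<^sub>J\<close>; the coefficients form the matrix \<open>A\<close>.\<close>

lemma minors_vanish_iff:
  fixes v w :: "'k::field mat"
  assumes v: "v \<in> carrier_mat r n" and w: "w \<in> carrier_mat r n" and J: "J \<subseteq> {..<n}"
    and perp: "is_perp (cols_submatrix v J) P"
  shows "(\<forall>p \<in> minors (card J) (col_tensor (cols_submatrix (generic_matrix r n) J) (map_mat const P)).
            eval_at w p = 0) \<longleftrightarrow>
    (\<exists>t A. (\<exists>j\<in>J. t j \<noteq> 0) \<and> (\<forall>a<r. \<forall>j\<in>J. w $$ (a, j) * t j = (\<Sum>i<r. A a i * v $$ (i, j))))"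
    (is "?minors \<longleftrightarrow> ?comb")
proof -
  let ?l = "card J" and ?d = "dim_row P"
  let ?M = "col_tensor (cols_submatrix w J) P"
  have fin: "finite J" using J finite_subset by blast
  note cv = carrier_matD[OF cols_submatrix_carrier[OF v J]]
    and cw = carrier_matD[OF cols_submatrix_carrier[OF w J]]
  have P: "dim_col P = ?l" using perp cv unfolding is_perp_def by auto
  have g: "(generic_matrix r n :: 'k mpoly2 mat) \<in> carrier_mat r n" by (simp add: generic_matrix_def)
  let ?T = "col_tensor (cols_submatrix (generic_matrix r n :: 'k mpoly2 mat) J) (map_mat const P)"
  have dims: "dim_row ?T = r * ?d" "dim_col ?T = ?l"
    using cols_submatrix_carrier[OF g J] by (auto simp: col_tensor_def)
  have M: "?M \<in> carrier_mat (r * ?d) ?l" using cw by (auto simp: col_tensor_def)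
  have M_idx: "?M $$ (a * ?d + c, b) = w $$ (a, pick J b) * P $$ (c, b)"
    if "a < r" "c < ?d" "b < ?l" for a b c
  proof -
    have "a * ?d + c < r * ?d"
      using that(1,2) by (rule row_index_less)
    then show ?thesis
      using that cw cols_submatrix_index[OF w J that(1,3)] by (simp add: col_tensor_def)
  qed
  have eval_det: "eval_at w (det (submatrix ?T I {..<?l})) = det (submatrix ?M I {..<?l})" for I
    by (simp add: eval.hom_det[symmetric] submatrix_map_mat[symmetric] eval_col_tensor[OF w J P])
  have cols: "K \<subseteq> {..<?l} \<and> card K = ?l \<longleftrightarrow> K = {..<?l}" for K
    using card_subset_eq[of "{..<?l}" K] by auto
  have minors_eq: "minors ?l ?T = {det (submatrix ?T I {..<?l}) | I. I \<subseteq> {..<r * ?d} \<and> card I = ?l}"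
    unfolding minors_def dims cols by simp
  have "?minors \<longleftrightarrow>
      (\<forall>I. I \<subseteq> {..<r * ?d} \<and> card I = ?l \<longrightarrow> eval_at w (det (submatrix ?T I {..<?l})) = 0)"
    unfolding minors_eq by blast
  also have "\<dots> \<longleftrightarrow> (\<forall>I. I \<subseteq> {..<r * ?d} \<and> card I = ?l \<longrightarrow> det (submatrix ?M I {..<?l}) = 0)"
    unfolding eval_det ..
  also have "\<dots> \<longleftrightarrow> (\<exists>t. (\<exists>b<?l. t b \<noteq> 0) \<and> (\<forall>i<r * ?d. (\<Sum>b<?l. ?M $$ (i, b) * t b) = 0))"
  proof
    assume vanish: "\<forall>I. I \<subseteq> {..<r * ?d} \<and> card I = ?l \<longrightarrow> det (submatrix ?M I {..<?l}) = 0"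
    obtain t where "\<exists>b<?l. t b \<noteq> 0" "\<And>i. i < r * ?d \<Longrightarrow> (\<Sum>b<?l. ?M $$ (i, b) * t b) = 0"
      by (rule kernel_if_minors_vanish[OF M]) (use vanish in blast)+
    then show "\<exists>t. (\<exists>b<?l. t b \<noteq> 0) \<and> (\<forall>i<r * ?d. (\<Sum>b<?l. ?M $$ (i, b) * t b) = 0)"
      by (intro exI[of _ t]) simp
  next
    assume "\<exists>t. (\<exists>b<?l. t b \<noteq> 0) \<and> (\<forall>i<r * ?d. (\<Sum>b<?l. ?M $$ (i, b) * t b) = 0)"
    then obtain t where t: "(\<exists>b<?l. t b \<noteq> 0) \<and> (\<forall>i<r * ?d. (\<Sum>b<?l. ?M $$ (i, b) * t b) = 0)" ..
    show "\<forall>I. I \<subseteq> {..<r * ?d} \<and> card I = ?l \<longrightarrow> det (submatrix ?M I {..<?l}) = 0"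
      using minors_vanish_if_kernel[OF M conjunct1[OF t] conjunct2[OF t, rule_format]] by simp
  qed
  also have "\<dots> \<longleftrightarrow> (\<exists>t. (\<exists>b<?l. t b \<noteq> 0) \<and>
      (\<forall>a<r. \<forall>c<?d. (\<Sum>b<?l. P $$ (c, b) * (w $$ (a, pick J b) * t b)) = 0))"
  proof (intro ex_cong conj_cong refl iffI allI impI)
    fix t a c
    assume *: "\<forall>i<r * ?d. (\<Sum>b<?l. ?M $$ (i, b) * t b) = 0" and a: "a < r" "c < ?d"
    have "a * ?d + c < r * ?d" using a by (rule row_index_less)
    then have "(\<Sum>b<?l. ?M $$ (a * ?d + c, b) * t b) = 0" using * by blast
    moreover have "(\<Sum>b<?l. ?M $$ (a * ?d + c, b) * t b) =
        (\<Sum>b<?l. P $$ (c, b) * (w $$ (a, pick J b) * t b))"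
      by (intro sum.cong) (simp_all add: M_idx[OF a] mult.assoc mult.left_commute)
    ultimately show "(\<Sum>b<?l. P $$ (c, b) * (w $$ (a, pick J b) * t b)) = 0" by simp
  next
    fix t i
    assume *: "\<forall>a<r. \<forall>c<?d. (\<Sum>b<?l. P $$ (c, b) * (w $$ (a, pick J b) * t b)) = 0"
      and i: "i < r * ?d"
    then have "?d > 0" by (cases ?d) auto
    then have a: "i div ?d < r" "i mod ?d < ?d"
      using i by (simp_all add: less_mult_imp_div_less)
    have "?M $$ (i, b) = w $$ (i div ?d, pick J b) * P $$ (i mod ?d, b)" if "b < ?l" for b
      using M_idx[OF a that] by simp
    then have "(\<Sum>b<?l. ?M $$ (i, b) * t b) =
        (\<Sum>b<?l. P $$ (i mod ?d, b) * (w $$ (i div ?d, pick J b) * t b))"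
      by (intro sum.cong) (simp_all add: algebra_simps)
    then show "(\<Sum>b<?l. ?M $$ (i, b) * t b) = 0" using * a by simp
  qed
  also have "\<dots> \<longleftrightarrow> (\<exists>t. (\<exists>b<?l. t b \<noteq> 0) \<and>
      (\<exists>A. \<forall>a<r. \<forall>b<?l. w $$ (a, pick J b) * t b = (\<Sum>i<r. A a i * v $$ (i, pick J b))))"
  proof (intro ex_cong conj_cong refl iffI)
    fix t assume *: "\<forall>a<r. \<forall>c<?d. (\<Sum>b<?l. P $$ (c, b) * (w $$ (a, pick J b) * t b)) = 0"
    have "\<exists>f. \<forall>b<?l. w $$ (a, pick J b) * t b = (\<Sum>i<r. f i * v $$ (i, pick J b))" if a: "a < r" for a
    proof -
      have "\<exists>f. \<forall>b\<in>{..<?l}. w $$ (a, pick J b) * t b = (\<Sum>i\<in>{..<r}. f i * cols_submatrix v J $$ (i, b))"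
      proof (rule functional_in_span)
        fix z assume "\<And>i. i \<in> {..<r} \<Longrightarrow> (\<Sum>b<?l. cols_submatrix v J $$ (i, b) * z b) = 0"
        then show "(\<Sum>b<?l. w $$ (a, pick J b) * t b * z b) = 0"
          using is_perp_spans_kernel[OF perp, of "\<lambda>b. w $$ (a, pick J b) * t b" z] * a cv by simp
      qed simp_all
      then show ?thesis using cols_submatrix_index[OF v J] by (simp add: Ball_def)
    qed
    then show "\<exists>A. \<forall>a<r. \<forall>b<?l. w $$ (a, pick J b) * t b = (\<Sum>i<r. A a i * v $$ (i, pick J b))"
      by metis
  next
    fix t assume "\<exists>A. \<forall>a<r. \<forall>b<?l. w $$ (a, pick J b) * t b = (\<Sum>i<r. A a i * v $$ (i, pick J b))"
    then obtain A where A: "\<And>a b. a < r \<Longrightarrow> b < ?l \<Longrightarrow>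
        w $$ (a, pick J b) * t b = (\<Sum>i<r. A a i * cols_submatrix v J $$ (i, b))"
      using cols_submatrix_index[OF v J] by auto
    show "\<forall>a<r. \<forall>c<?d. (\<Sum>b<?l. P $$ (c, b) * (w $$ (a, pick J b) * t b)) = 0"
    proof (intro allI impI)
      fix a c assume a: "a < r" and c: "c < ?d"
      have "(\<Sum>b<?l. P $$ (c, b) * (w $$ (a, pick J b) * t b)) =
          (\<Sum>b<?l. \<Sum>i<r. A a i * (cols_submatrix v J $$ (i, b) * P $$ (c, b)))"
        by (intro sum.cong) (simp_all add: A[OF a] sum_distrib_left mult.left_commute mult.commute[of "P $$ _"])
      also have "\<dots> = (\<Sum>i<r. A a i * (\<Sum>b<?l. cols_submatrix v J $$ (i, b) * P $$ (c, b)))"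
        by (subst sum.swap) (simp add: sum_distrib_left)
      also have "\<dots> = 0"
        using is_perp_in_kernel[OF perp c] cv by simp
      finally show "(\<Sum>b<?l. P $$ (c, b) * (w $$ (a, pick J b) * t b)) = 0" .
    qed
  qed
  also have "\<dots> \<longleftrightarrow> ?comb"
  proof
    have bij: "bij_betw (pick J) {..<?l} J" by (rule bij_betw_pick[OF fin])
    let ?inv = "the_inv_into {..<?l} (pick J)"
    have inv: "?inv j < ?l" "pick J (?inv j) = j" if "j \<in> J" for j
      using that bij f_the_inv_into_f_bij_betw[OF bij] bij_betw_the_inv_into[OF bij]
      unfolding bij_betw_def by auto
    have inv': "?inv (pick J b) = b" if "b < ?l" for b
      using that bij by (simp add: bij_betw_def the_inv_into_f_f)
    assume "\<exists>t. (\<exists>b<?l. t b \<noteq> 0) \<and>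
      (\<exists>A. \<forall>a<r. \<forall>b<?l. w $$ (a, pick J b) * t b = (\<Sum>i<r. A a i * v $$ (i, pick J b)))"
    then obtain t A b where t: "b < ?l" "t b \<noteq> 0"
      "\<forall>a<r. \<forall>b<?l. w $$ (a, pick J b) * t b = (\<Sum>i<r. A a i * v $$ (i, pick J b))" by blast
    show ?comb
    proof (intro exI[of _ "\<lambda>j. t (?inv j)"] exI[of _ A] conjI bexI[of _ "pick J b"])
      show "t (?inv (pick J b)) \<noteq> 0" "pick J b \<in> J" using t inv' pick_in_set by auto
      show "\<forall>a<r. \<forall>j\<in>J. w $$ (a, j) * t (?inv j) = (\<Sum>i<r. A a i * v $$ (i, j))"
      proof (intro allI impI ballI)
        fix a j assume "a < r" and j: "j \<in> J"
        then show "w $$ (a, j) * t (?inv j) = (\<Sum>i<r. A a i * v $$ (i, j))"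
          using t(3)[rule_format, OF _ inv(1)[OF j], of a] inv(2)[OF j] by simp
      qed
    qed
  next
    have bij: "bij_betw (pick J) {..<?l} J" by (rule bij_betw_pick[OF fin])
    assume ?comb
    then obtain t A j where t: "j \<in> J" "t j \<noteq> 0"
      "\<forall>a<r. \<forall>j\<in>J. w $$ (a, j) * t j = (\<Sum>i<r. A a i * v $$ (i, j))" by blast
    obtain b where "b < ?l" "j = pick J b" using bij t(1) unfolding bij_betw_def by auto
    then show "\<exists>t. (\<exists>b<?l. t b \<noteq> 0) \<and>
      (\<exists>A. \<forall>a<r. \<forall>b<?l. w $$ (a, pick J b) * t b = (\<Sum>i<r. A a i * v $$ (i, pick J b)))"
      using t pick_in_set by (intro exI[of _ "\<lambda>b. t (pick J b)"]) blast
  qed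
  finally show ?thesis .
qed

section \<open>Degenerations of the orbit\<close>

text \<open>The value of \<open>p\<close> along a polynomial curve of matrices is a polynomial \<open>F\<close> in the parameter, which is
  zero if it has infinitely many roots.\<close>

lemma eval_along_curve:
  fixes p :: "'k::field_char_0 mpoly2"
  assumes p: "p \<in> carrier (coord_ring r n)"
    and fin: "finite {e. eval_at (mat r n (\<lambda>ij. poly (Q ij) e)) p \<noteq> 0}"
  shows "eval_at (mat r n (\<lambda>ij. poly (Q ij) e)) p = 0"
proof -
  define F where "F = (\<Sum>m \<in> Poly_Mapping.keys p. [:Poly_Mapping.lookup p m:] *
      (\<Prod>ij \<in> Poly_Mapping.keys m. Q ij ^ Poly_Mapping.lookup m ij))"
  have F: "poly F e = eval_at (mat r n (\<lambda>ij. poly (Q ij) e)) p" for e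
    unfolding F_def eval_at_def poly_sum
  proof (rule sum.cong[OF refl])
    fix m assume "m \<in> Poly_Mapping.keys p"
    then have "ij \<in> {..<r} \<times> {..<n}" if "ij \<in> Poly_Mapping.keys m" for ij
      using p that unfolding coord_ring_def by auto
    then show "poly ([:Poly_Mapping.lookup p m:] * (\<Prod>ij\<in>Poly_Mapping.keys m. Q ij ^ Poly_Mapping.lookup m ij)) e =
        Poly_Mapping.lookup p m *
        (\<Prod>ij\<in>Poly_Mapping.keys m. mat r n (\<lambda>ij. poly (Q ij) e) $$ ij ^ Poly_Mapping.lookup m ij)"
      by (auto simp: poly_prod intro!: prod.cong arg_cong[of _ _ "\<lambda>x. _ * x"])
  qed
  have "infinite {e. poly F e = 0}"
  proof
    assume "finite {e. poly F e = 0}"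
    then have "finite ({e. poly F e = 0} \<union> {e. poly F e \<noteq> 0})" using fin F by simp
    moreover have "{e. poly F e = 0} \<union> {e. poly F e \<noteq> 0} = UNIV" by auto
    ultimately show False using infinite_UNIV_char_0[where 'a = 'k] by simp
  qed
  then have "F = 0" using poly_roots_finite by blast
  then show ?thesis using F by (metis poly_0)
qed

lemma invertible_mat_if_det_nonzero:
  fixes A :: "'k::field mat"
  assumes A: "A \<in> carrier_mat m m" and det: "det A \<noteq> 0"
  shows "invertible_mat A"
proof -
  obtain B where "B \<in> carrier_mat m m" "B * A = 1\<^sub>m m" "A * B = 1\<^sub>m m"
    using det_non_zero_imp_unit[OF A det, unfolded Units_def, of "()"] by (auto simp: ring_mat_def)
  then show ?thesis using A by (auto simp: invertible_mat_def inverts_mat_def square_mat.simps)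
qed

text \<open>The matrix \<open>B\<close> need not be invertible, but \<open>B - e\<close> is invertible unless \<open>e\<close> is one of the finitely many
  eigenvalues of \<open>B\<close>. So \<open>p\<close> vanishes on the curve \<open>(B - e) v diag(s)\<close> for almost all \<open>e\<close>, hence also at
  \<open>e = 0\<close>.\<close>

lemma vanishes_at_singular_multiples:
  fixes v :: "'k::field_char_0 mat"
  assumes p: "p \<in> carrier (coord_ring r n)" and orbit: "\<And>w. w \<in> matrix_orbit r n v \<Longrightarrow> eval_at w p = 0"
    and v: "v \<in> carrier_mat r n" and B: "B \<in> carrier_mat r r" and s: "\<And>j. j < n \<Longrightarrow> s j \<noteq> 0"
  shows "eval_at (B * v * mat_diag n s) p = 0"
proof -
  define Q where "Q = (\<lambda>(i, j). [:(B * v) $$ (i, j) * s j, - v $$ (i, j) * s j:])"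
  have curve: "mat r n (\<lambda>ij. poly (Q ij) e) = char_matrix B e * v * mat_diag n s" for e
  proof -
    have "char_matrix B e * v = B * v + (- e) \<cdot>\<^sub>m v"
      using v B unfolding char_matrix_def
      by (subst add_mult_distrib_mat[of _ r r]) auto
    then show ?thesis
      using v B by (intro eq_matI) (auto simp: Q_def mat_diag_mult_right[of _ r n] algebra_simps)
  qed
  have "char_poly B \<noteq> 0" using degree_monic_char_poly[OF B] by (cases r) auto
  then have "finite {e. poly (char_poly B) e = 0}" by (rule poly_roots_finite)
  moreover have "{e. eval_at (mat r n (\<lambda>ij. poly (Q ij) e)) p \<noteq> 0} \<subseteq> {e. poly (char_poly B) e = 0}"
  proof (intro subsetI CollectI, rule ccontr)
    fix e assume e: "e \<in> {e. eval_at (mat r n (\<lambda>ij. poly (Q ij) e)) p \<noteq> 0}"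
      and "poly (char_poly B) e \<noteq> 0"
    then have "det (char_matrix B e) \<noteq> 0"
      using eigenvalue_root_char_poly[OF B] eigenvalue_det[OF B] by blast
    moreover have C: "char_matrix B e \<in> carrier_mat r r" using B by (simp add: char_matrix_def)
    ultimately have "invertible_mat (char_matrix B e)" 
      using invertible_mat_if_det_nonzero by blast
    then have "char_matrix B e * v * mat_diag n s \<in> matrix_orbit r n v"
      unfolding matrix_orbit_def using C s by blast
    then show False using orbit e by (simp add: curve)
  qed
  ultimately have "finite {e. eval_at (mat r n (\<lambda>ij. poly (Q ij) e)) p \<noteq> 0}"
    using finite_subset by blast
  moreover have "char_matrix B 0 = B" using B by (intro eq_matI) (auto simp: char_matrix_def)
  ultimately show ?thesis using eval_along_curve[OF p, of Q 0] unfolding curve by simp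
qed

text \<open>Induction on \<open>J\<close>. Let \<open>t\<close> and \<open>A\<close> be given by the hypothesis for \<open>J\<close> itself, and let \<open>G\<close> be the family for
  the smaller set where \<open>t\<close> vanishes. Then \<open>A + \<epsilon> G\<close> works for \<open>J\<close>. Where \<open>t j \<noteq> 0\<close>, the matrix \<open>A\<close> maps
  the column \<open>v\<^sub>j\<close> to \<open>t j\<close> times \<open>w\<^sub>j\<close>, and \<open>\<epsilon> G\<close> contributes to higher order only. Where \<open>t j = 0\<close>,
  the matrix \<open>A\<close> kills \<open>v\<^sub>j\<close>, and the factor \<open>\<epsilon>\<close> raises the order \<open>d\<close> by one.\<close>

lemma degenerating_family:
  fixes v w :: "nat \<Rightarrow> nat \<Rightarrow> 'k::field"
  assumes "finite J"
    and comb: "\<And>K. K \<subseteq> J \<Longrightarrow> K \<noteq> {} \<Longrightarrow>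
      \<exists>t A. (\<exists>j\<in>K. t j \<noteq> 0) \<and> (\<forall>a<r. \<forall>j\<in>K. w a j * t j = (\<Sum>i<r. A a i * v i j))"
  shows "\<exists>G. \<forall>j\<in>J. \<exists>d c q. c \<noteq> 0 \<and>
    (\<forall>a<r. (\<Sum>i<r. G a i * [:v i j:]) = monom c d * ([:w a j:] + [:0, 1:] * q a))"
  using assms
proof (induction J rule: finite_psubset_induct)
  case (psubset J)
  show ?case
  proof (cases "J = {}")
    case False
    then obtain t A where t: "\<exists>j\<in>J. t j \<noteq> 0"
        and A: "\<And>a j. a < r \<Longrightarrow> j \<in> J \<Longrightarrow> w a j * t j = (\<Sum>i<r. A a i * v i j)"
      using psubset.prems[of J] by blast
    let ?K = "{j \<in> J. t j = 0}"
    have "?K \<subset> J" using t by blast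
    then have "\<exists>G. \<forall>j\<in>?K. \<exists>d c q. c \<noteq> 0 \<and>
        (\<forall>a<r. (\<Sum>i<r. G a i * [:v i j:]) = monom c d * ([:w a j:] + [:0, 1:] * q a))"
    proof (rule psubset.IH)
      fix K assume "K \<subseteq> ?K" "K \<noteq> {}"
      then show "\<exists>t A. (\<exists>j\<in>K. t j \<noteq> 0) \<and> (\<forall>a<r. \<forall>j\<in>K. w a j * t j = (\<Sum>i<r. A a i * v i j))"
        by (intro psubset.prems) auto
    qed
    then obtain G where G: "\<forall>j\<in>?K. \<exists>d c q. c \<noteq> 0 \<and>
        (\<forall>a<r. (\<Sum>i<r. G a i * [:v i j:]) = monom c d * ([:w a j:] + [:0, 1:] * q a))" ..
    define G' where "G' a i = [:A a i:] + [:0, 1:] * G a i" for a i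
    have G': "(\<Sum>i<r. G' a i * [:v i j:]) = [:w a j * t j:] + [:0, 1:] * (\<Sum>i<r. G a i * [:v i j:])"
      if "a < r" "j \<in> J" for a j
    proof -
      have "(\<Sum>i<r. [:A a i:] * [:v i j:]) = [:w a j * t j:]"
        unfolding A[OF that] by (intro poly_eqI) (simp add: coeff_sum coeff_pCons mult.commute split: nat.split)
      then show ?thesis
        unfolding G'_def by (simp only: distrib_right sum.distrib sum_distrib_left mult.assoc)
    qed
    have "\<exists>d c q. c \<noteq> 0 \<and>
        (\<forall>a<r. (\<Sum>i<r. G' a i * [:v i j:]) = monom c d * ([:w a j:] + [:0, 1:] * q a))"
      if j: "j \<in> J" for j
    proof (cases "t j = 0")
      case True
      then obtain d c q where q: "c \<noteq> 0"
          "\<And>a. a < r \<Longrightarrow> (\<Sum>i<r. G a i * [:v i j:]) = monom c d * ([:w a j:] + [:0, 1:] * q a)"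
        using bspec[OF G, of j] j by auto
      have "monom c (Suc d) = [:0, 1:] * monom c d" by (simp add: monom_Suc)
      then have "(\<Sum>i<r. G' a i * [:v i j:]) = monom c (Suc d) * ([:w a j:] + [:0, 1:] * q a)"
        if "a < r" for a
        using G'[OF that j] q(2)[OF that] True by (simp only: mult.assoc) simp
      then show ?thesis using q(1) by blast
    next
      case False
      have "(\<Sum>i<r. G' a i * [:v i j:]) = monom (t j) 0 *
          ([:w a j:] + [:0, 1:] * ([:1 / t j:] * (\<Sum>i<r. G a i * [:v i j:])))" if "a < r" for a
        using G'[OF that j] False by (simp add: monom_0 smult_add_right mult.commute)
      then show ?thesis using False
        by (intro exI[of _ 0] exI[of _ "t j"] exI[of _ "\<lambda>a. [:1 / t j:] * (\<Sum>i<r. G a i * [:v i j:])"]) blast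
    qed
    then show ?thesis by blast
  qed simp
qed

text \<open>Dividing the columns of the family from \<open>degenerating_family\<close> by \<open>c \<epsilon>\<^sup>d\<close> gives a polynomial curve \<open>Q\<close>
  through \<open>w\<close>. For \<open>\<epsilon> \<noteq> 0\<close> it consists of matrices \<open>B v diag(s)\<close> with nonzero \<open>s\<close>.\<close>

lemma vanishes_at_degenerations:
  fixes v w :: "'k::field_char_0 mat"
  assumes p: "p \<in> carrier (coord_ring r n)" and orbit: "\<And>w. w \<in> matrix_orbit r n v \<Longrightarrow> eval_at w p = 0"
    and v: "v \<in> carrier_mat r n" and w: "w \<in> carrier_mat r n"
    and comb: "\<And>J. J \<subseteq> {..<n} \<Longrightarrow> J \<noteq> {} \<Longrightarrow>
      \<exists>t A. (\<exists>j\<in>J. t j \<noteq> 0) \<and> (\<forall>a<r. \<forall>j\<in>J. w $$ (a, j) * t j = (\<Sum>i<r. A a i * v $$ (i, j)))"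
  shows "eval_at w p = 0"
proof -
  obtain G where "\<forall>j\<in>{..<n}. \<exists>d c q. c \<noteq> 0 \<and> (\<forall>a<r. (\<Sum>i<r. G a i * [:v $$ (i, j):]) =
      monom c d * ([:w $$ (a, j):] + [:0, 1:] * q a))"
    using degenerating_family[OF finite_lessThan comb] by blast
  then have "\<exists>d c q. \<forall>j\<in>{..<n}. c j \<noteq> 0 \<and> (\<forall>a<r. (\<Sum>i<r. G a i * [:v $$ (i, j):]) =
      monom (c j) (d j) * ([:w $$ (a, j):] + [:0, 1:] * q j a))"
    unfolding bchoice_iff .
  then obtain d c q where dcq: "\<forall>j\<in>{..<n}. c j \<noteq> 0 \<and> (\<forall>a<r. (\<Sum>i<r. G a i * [:v $$ (i, j):]) =
      monom (c j) (d j) * ([:w $$ (a, j):] + [:0, 1:] * q j a))"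
    by (elim exE) (rule that)
  have c: "c j \<noteq> 0" if "j < n" for j using dcq that by simp
  have G: "(\<Sum>i<r. G a i * [:v $$ (i, j):]) = monom (c j) (d j) * ([:w $$ (a, j):] + [:0, 1:] * q j a)"
    if "a < r" "j < n" for a j
    using bspec[OF dcq, of j] that by simp
  define Q where "Q = (\<lambda>(a, j). [:w $$ (a, j):] + [:0, 1:] * q j a)"
  have "eval_at (mat r n (\<lambda>ij. poly (Q ij) e)) p = 0" if e: "e \<noteq> 0" for e
  proof -
    define B where "B = mat r r (\<lambda>(a, i). poly (G a i) e)"
    define s where "s j = 1 / (c j * e ^ d j)" for j
    have s: "s j \<noteq> 0" if "j < n" for j using c[OF that] e by (simp add: s_def)
    have "mat r n (\<lambda>ij. poly (Q ij) e) = B * v * mat_diag n s"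
    proof (rule eq_matI)
      fix a j assume "a < dim_row (B * v * mat_diag n s)" "j < dim_col (B * v * mat_diag n s)"
      then have aj: "a < r" "j < n" by (simp_all add: B_def mat_diag_def)
      have "(B * v) $$ (a, j) = (\<Sum>i<r. poly (G a i) e * v $$ (i, j))"
        using aj v by (auto simp: B_def scalar_prod_def lessThan_atLeast0 intro!: sum.cong)
      also have "\<dots> = c j * e ^ d j * poly (Q (a, j)) e"
        using arg_cong[OF G[OF aj], of "\<lambda>f. poly f e"]
        by (simp add: poly_sum poly_monom Q_def algebra_simps)
      finally have "(B * v) $$ (a, j) * s j = poly (Q (a, j)) e"
        using c[OF aj(2)] e by (simp add: s_def)
      moreover have "B * v \<in> carrier_mat r n" unfolding B_def by (rule mult_carrier_mat[OF mat_carrier v])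
      ultimately show "mat r n (\<lambda>ij. poly (Q ij) e) $$ (a, j) = (B * v * mat_diag n s) $$ (a, j)"
        using aj by (simp add: mat_diag_mult_right)
    qed (simp_all add: B_def mat_diag_def)
    then show ?thesis using vanishes_at_singular_multiples[OF p orbit v _ s, of B] by (simp add: B_def)
  qed
  then have "{e. eval_at (mat r n (\<lambda>ij. poly (Q ij) e)) p \<noteq> 0} \<subseteq> {0}" by blast
  then have "eval_at (mat r n (\<lambda>ij. poly (Q ij) 0)) p = 0"
    using eval_along_curve[OF p] finite_subset by blast
  moreover have "mat r n (\<lambda>ij. poly (Q ij) 0) = w"
    using w by (intro eq_matI) (auto simp: Q_def)
  ultimately show ?thesis by simp
qed

section \<open>The ideal of minors and the orbit closure\<close>

lemma matrix_orbit_carrier: "v \<in> carrier_mat r n \<Longrightarrow> matrix_orbit r n v \<subseteq> carrier_mat r n"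
  unfolding matrix_orbit_def by (auto intro!: mult_carrier_mat)

text \<open>The zero locus of a polynomial that vanishes on the orbit is closed, hence contains the orbit closure.\<close>

lemma orbit_ideal_eq:
  assumes "v \<in> carrier_mat r n"
  shows "orbit_ideal r n v = vanishing_ideal r n (matrix_orbit r n v)"
proof
  show "orbit_ideal r n v \<subseteq> vanishing_ideal r n (matrix_orbit r n v)"
    unfolding orbit_ideal_def vanishing_ideal_def orbit_closure_def zariski_closure_def by blast
  show "vanishing_ideal r n (matrix_orbit r n v) \<subseteq> orbit_ideal r n v"
  proof
    fix p assume p: "p \<in> vanishing_ideal r n (matrix_orbit r n v)"
    then have "zariski_closed r n (zero_locus r n {p})" "matrix_orbit r n v \<subseteq> zero_locus r n {p}"
      using matrix_orbit_carrier[OF assms]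
      unfolding zariski_closed_def vanishing_ideal_def zero_locus_def by blast+
    then have "orbit_closure r n v \<subseteq> zero_locus r n {p}"
      unfolding orbit_closure_def zariski_closure_def by blast
    then show "p \<in> orbit_ideal r n v"
      using p unfolding orbit_ideal_def vanishing_ideal_def zero_locus_def by blast
  qed
qed

lemma (in unital_subring) det_mem:
  assumes "\<And>i j. i < dim_row M \<Longrightarrow> j < dim_col M \<Longrightarrow> M $$ (i, j) \<in> B"
  shows "det M \<in> B"
proof -
  have sgn: "signof \<pi> \<in> B" for \<pi> using one_mem uminus_mem by (simp add: sign_def)
  have prod: "prod f X \<in> B" if "\<And>x. x \<in> X \<Longrightarrow> f x \<in> B" for f :: "nat \<Rightarrow> 'a" and X
    using that by (induction X rule: infinite_finite_induct) (auto simp: one_mem mult_mem)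
  show ?thesis
    unfolding det_def using assms zero_mem
    by (auto intro!: sum_mem mult_mem sgn prod simp: permutes_in_image)
qed

lemma minors_in_coord_ring:
  fixes P :: "'k::comm_ring_1 mat"
  assumes J: "J \<subseteq> {..<n}" and P: "dim_col P = card J"
  shows "minors k (col_tensor (cols_submatrix (generic_matrix r n) J) (map_mat const P))
    \<subseteq> carrier (coord_ring r n)"
proof -
  let ?C = "carrier (coord_ring r n) :: 'k mpoly2 set"
  interpret C: unital_subring ?C by (rule unital_subring_coord_ring)
  let ?X = "generic_matrix r n :: 'k mpoly2 mat"
  let ?T = "col_tensor (cols_submatrix ?X J) (map_mat const P)"
  have X: "?X \<in> carrier_mat r n" by (simp add: generic_matrix_def)
  note dims = carrier_matD[OF cols_submatrix_carrier[OF X J]]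
  have T: "?T $$ (i, j) \<in> ?C" if "i < dim_row ?T" "j < dim_col ?T" for i j
  proof -
    have ij: "i < r * dim_row P" "j < card J" using that dims by (simp_all add: col_tensor_def)
    then have "dim_row P > 0" by (cases "dim_row P") auto
    moreover have i: "i div dim_row P < r" using ij(1) by (simp add: less_mult_imp_div_less)
    moreover have "pick J j < n" using pick_in_set[of j J] ij(2) J by auto
    then have "?X $$ (i div dim_row P, pick J j) \<in> ?C"
      using i by (simp add: generic_matrix_def var_mem)
    ultimately show ?thesis
      using ij P dims by (simp add: col_tensor_def cols_submatrix_index[OF X J] C.mult_mem const_mem)
  qed
  have "det (submatrix ?T I K) \<in> ?C" for I K
    by (rule C.det_mem) (simp add: submatrix_def T pick_le)
  then show ?thesis unfolding minors_def by blast
qed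

text \<open>The polynomials that vanish at a given point form an ideal.\<close>

lemma zero_locus_genideal:
  fixes S :: "'k::comm_ring_1 mpoly2 set"
  assumes S: "S \<subseteq> carrier (coord_ring r n)"
  shows "zero_locus r n (Idl\<^bsub>coord_ring r n\<^esub> S) = zero_locus r n S"
proof -
  let ?R = "coord_ring r n :: 'k mpoly2 ring"
  interpret R: cring ?R by (rule cring_coord_ring)
  interpret C: unital_subring "carrier ?R" by (rule unital_subring_coord_ring)
  have "eval_at w p = 0" if w: "\<forall>p\<in>S. eval_at w p = 0" and p: "p \<in> Idl\<^bsub>?R\<^esub> S" for w p
  proof -
    let ?K = "{p \<in> carrier ?R. eval_at w p = 0}"
    have neg: "\<ominus>\<^bsub>?R\<^esub> q = - q" if "q \<in> carrier ?R" for q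
      using that C.uminus_mem by (intro R.minus_equality) (simp_all add: coord_ring_simps)
    have "ideal ?K ?R"
    proof (rule idealI[OF R.ring_axioms])
      show "subgroup ?K (add_monoid ?R)"
      proof (rule R.add.subgroupI)
        show "?K \<noteq> {}" using C.zero_mem eval_at_zero by blast
        show "\<ominus>\<^bsub>?R\<^esub> q \<in> ?K" if "q \<in> ?K" for q
          using that neg C.uminus_mem by (simp add: eval.hom_uminus)
        show "p \<oplus>\<^bsub>?R\<^esub> q \<in> ?K" if "p \<in> ?K" "q \<in> ?K" for p q
          using that C.add_mem by (simp add: coord_ring_simps eval_at_add)
      qed blast
      show "x \<otimes>\<^bsub>?R\<^esub> a \<in> ?K" "a \<otimes>\<^bsub>?R\<^esub> x \<in> ?K" if "a \<in> ?K" "x \<in> carrier ?R" for a x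
        using that C.mult_mem by (simp_all add: coord_ring_simps eval_at_mult)
    qed
    moreover have "S \<subseteq> ?K" using S w by blast
    ultimately show ?thesis using R.genideal_minimal p by blast
  qed
  then show ?thesis
    using R.genideal_self[OF S] unfolding zero_locus_def by blast
qed

theorem theorem4p3:
  fixes r n :: nat
    and v :: "'k::{alg_closed_field, field_char_0} mat"
    and perp :: "nat set \<Rightarrow> 'k mat"
  assumes "v \<in> carrier_mat r n"
    and "\<And>J. J \<subseteq> {..<n} \<Longrightarrow> J \<noteq> {} \<Longrightarrow> is_perp (cols_submatrix v J) (perp J)"
  shows "radical (coord_ring r n) (minors_ideal r n perp) = orbit_ideal r n v"
proof -
  let ?R = "coord_ring r n :: 'k mpoly2 ring"
  interpret R: cring ?R by (rule cring_coord_ring)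
  define \<J> where "\<J> = {J. J \<subseteq> {..<n} \<and> J \<noteq> {}}"
  define gens where "gens J =
    minors (card J) (col_tensor (cols_submatrix (generic_matrix r n) J) (map_mat const (perp J)))" for J
  define dependent where "dependent w J \<longleftrightarrow> (\<exists>t A. (\<exists>j\<in>J. t j \<noteq> 0) \<and>
    (\<forall>a<r. \<forall>j\<in>J. w $$ (a, j) * t j = (\<Sum>i<r. A a i * v $$ (i, j))))" for w :: "'k mat" and J :: "nat set"
  have minors_ideal: "minors_ideal r n perp = Idl\<^bsub>?R\<^esub> (\<Union>J\<in>\<J>. gens J)"
    unfolding minors_ideal_def gens_def \<J>_def ..
  have gens: "(\<Union>J\<in>\<J>. gens J) \<subseteq> carrier ?R"
  proof (rule UN_least)
    fix J assume "J \<in> \<J>"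
    then have J: "J \<subseteq> {..<n}" "J \<noteq> {}" by (auto simp: \<J>_def)
    have "dim_col (perp J) = card J"
      using assms(2)[OF J] carrier_matD[OF cols_submatrix_carrier[OF assms(1) J(1)]]
      by (auto simp: is_perp_def)
    then show "gens J \<subseteq> carrier ?R" unfolding gens_def by (rule minors_in_coord_ring[OF J(1)])
  qed
  have gens_vanish: "(\<forall>p\<in>gens J. eval_at w p = 0) \<longleftrightarrow> dependent w J"
    if "w \<in> carrier_mat r n" "J \<in> \<J>" for w J
    unfolding gens_def dependent_def
    using minors_vanish_iff[OF assms(1) that(1) _ assms(2)] that(2) by (simp add: \<J>_def)
  have locus: "zero_locus r n (minors_ideal r n perp) = {w \<in> carrier_mat r n. \<forall>J\<in>\<J>. dependent w J}"
    unfolding minors_ideal zero_locus_genideal[OF gens]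
    using gens_vanish by (auto simp: zero_locus_def)
  have orbit_sub: "matrix_orbit r n v \<subseteq> zero_locus r n (minors_ideal r n perp)"
  proof
    fix w assume w: "w \<in> matrix_orbit r n v"
    then obtain g s where g: "w = g * v * mat_diag n s" "g \<in> carrier_mat r r" "\<And>j. j < n \<Longrightarrow> s j \<noteq> 0"
      unfolding matrix_orbit_def by blast
    have "dependent w J" if "J \<in> \<J>" for J
    proof -
      have J: "J \<subseteq> {..<n}" "J \<noteq> {}" using that by (auto simp: \<J>_def)
      have "w $$ (a, j) * (1 / s j) = (\<Sum>i<r. g $$ (a, i) * v $$ (i, j))" if "a < r" "j \<in> J" for a j
      proof -
        have j: "j < n" using that(2) J(1) by auto
        have "g * v \<in> carrier_mat r n" using g(2) assms(1) by simp
        then have "w $$ (a, j) = (g * v) $$ (a, j) * s j"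
          using that(1) j by (simp add: g(1) mat_diag_mult_right)
        moreover have "(g * v) $$ (a, j) = (\<Sum>i<r. g $$ (a, i) * v $$ (i, j))"
          using that(1) j g(2) assms(1)
          by (auto simp: scalar_prod_def lessThan_atLeast0 intro!: sum.cong)
        ultimately show ?thesis using g(3)[OF j] by simp
      qed
      moreover have "\<exists>j\<in>J. 1 / s j \<noteq> 0" using J g(3) by auto
      ultimately show ?thesis
        unfolding dependent_def by (intro exI[of _ "\<lambda>j. 1 / s j"] exI[of _ "\<lambda>a i. g $$ (a, i)"]) simp
    qed
    then show "w \<in> zero_locus r n (minors_ideal r n perp)"
      unfolding locus using w matrix_orbit_carrier[OF assms(1)] by blast
  qed
  have "radical ?R (minors_ideal r n perp) = vanishing_ideal r n (zero_locus r n (minors_ideal r n perp))"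
    unfolding minors_ideal by (rule nullstellensatz[OF R.genideal_ideal[OF gens]])
  also have "\<dots> = vanishing_ideal r n (matrix_orbit r n v)"
  proof
    show "vanishing_ideal r n (zero_locus r n (minors_ideal r n perp)) \<subseteq> vanishing_ideal r n (matrix_orbit r n v)"
      using orbit_sub unfolding vanishing_ideal_def by blast
    show "vanishing_ideal r n (matrix_orbit r n v) \<subseteq> vanishing_ideal r n (zero_locus r n (minors_ideal r n perp))"
    proof
      fix p assume p: "p \<in> vanishing_ideal r n (matrix_orbit r n v)"
      have "eval_at w p = 0" if "w \<in> zero_locus r n (minors_ideal r n perp)" for w
      proof (rule vanishes_at_degenerations[OF _ _ assms(1)])
        show "p \<in> carrier ?R" "\<And>w. w \<in> matrix_orbit r n v \<Longrightarrow> eval_at w p = 0"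
          using p by (simp_all add: vanishing_ideal_def)
        show "w \<in> carrier_mat r n" using that locus by simp
        show "\<exists>t A. (\<exists>j\<in>J. t j \<noteq> 0) \<and> (\<forall>a<r. \<forall>j\<in>J. w $$ (a, j) * t j = (\<Sum>i<r. A a i * v $$ (i, j)))"
          if "J \<subseteq> {..<n}" "J \<noteq> {}" for J
          using \<open>w \<in> zero_locus r n (minors_ideal r n perp)\<close> that unfolding locus \<J>_def
          by (simp add: dependent_def)
      qed
      then show "p \<in> vanishing_ideal r n (zero_locus r n (minors_ideal r n perp))"
        using p by (simp add: vanishing_ideal_def)
    qed
  qed
  also have "\<dots> = orbit_ideal r n v" by (rule orbit_ideal_eq[OF assms(1), symmetric])
  finally show ?thesis .
qed

end
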